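(* Let $A$ be an $n\times n$ permutation matrix and let $X$ be an $n\times n$ doubly stochastic matrix. Then $AXA=XAX$ if and only if there is an $A$-invariant subspace $W\subseteq\mathbb R^n$ such that $X$ is obtained as a matrix $X_W$ by the procedure with prescribed kernel $W$ described in the context. In that case, $\mathcal N(X)=W$.
   Context: A doubly stochastic matrix is a real square matrix with nonnegative entries, all of whose row sums and column sums equal $1$. $U_k$ is the $k\times k$ matrix with all entries $1/k$. $\mathcal N(\cdot)$ and $\mathcal R(\cdot)$ denote null space and range, and $M\upharpoonright_V$ is the restriction of $M$ to $V$. Procedure with prescribed kernel $W$. Input: the permutation matrix $A$ and an $A$-invariant subspace $W$ of $\mathbb R^n$. (i) Let $Z_W$ be the orthogonal projector on $\mathbb R^n$ with $\mathcal N(Z_W)=W$. If $Z_W$ is not doubly stochastic, the procedure yields nothing for this $W$. Otherwise continue. (ii) Let $T_W$ be a permutation matrix such that $Z'=T_W^{-1}Z_WT_W$ has the form $Z'=\operatorname{diag}(Z'_1,\dots,Z'_m)$, where $Z'_i=\operatorname{diag}(U_{k_i},\dots,U_{k_i})$ is of size $d_i\times d_i$ (with $d_i/k_i$ copies of $U_{k_i}$) and $k_1,\dots,k_m$ are pairwise different positive integers. (Every doubly stochastic projection admits such a $T_W$.) (iii) Put $A'=T_W^{-1}AT_W$. Then $A'$ is block diagonal, $A'=\operatorname{diag}(A'_1,\dots,A'_m)$, with $A'_i$ a $d_i\times d_i$ permutation matrix commuting with $Z'_i$. (iv) For each $i$ choose a $d_i\times d_i$ permutation matrix $Q'_i$ which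 commutes with $Z'_i$ and satisfies $(A'_iQ'_iA'_i)\upharpoonright_{\mathcal R(Z'_i)}=(Q'_iA'_iQ'_i)\upharpoonright_{\mathcal R(Z'_i)}$. (v) Put $X'_i=Z'_iQ'_i$, $X'=\operatorname{diag}(X'_1,\dots,X'_m)$, and $X_W=T_WX'T_W^{-1}$. "$X$ is obtained as $X_W$" means that $X$ equals the output $X_W$ for some admissible choices in these steps. *)

theory Defs
  imports
    "Jordan_Normal_Form.Matrix_Kernel"
    "HOL-Combinatorics.Permutations"
begin

definition permutation_matrix :: "nat \<Rightarrow> real mat \<Rightarrow> bool" where
  "permutation_matrix n P \<longleftrightarrow>
     (\<exists>\<pi>. \<pi> permutes {..<n} \<and> P = mat n n (\<lambda>(i, j). if i = \<pi> j then 1 else 0))"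

definition doubly_stochastic :: "nat \<Rightarrow> real mat \<Rightarrow> bool" where
  "doubly_stochastic n M \<longleftrightarrow>
     M \<in> carrier_mat n n \<and>
     (\<forall>i<n. \<forall>j<n. 0 \<le> M $$ (i, j)) \<and>
     (\<forall>i<n. (\<Sum>j<n. M $$ (i, j)) = 1) \<and>
     (\<forall>j<n. (\<Sum>i<n. M $$ (i, j)) = 1)"

definition uniform_mat :: "nat \<Rightarrow> real mat" where
  "uniform_mat k = mat k k (\<lambda>(i, j). 1 / real k)"

definition mat_range :: "real mat \<Rightarrow> real vec set" where
  "mat_range M = (\<lambda>v. M *\<^sub>v v) ` carrier_vec (dim_col M)"

definition orthogonal_projector :: "nat \<Rightarrow> real mat \<Rightarrow> bool" where
  "orthogonal_projector n Z \<longleftrightarrow> Z \<in> carrier_mat n n \<and> Z * Z = Z \<and> transpose_mat Z = Z"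

definition invariant_subspace :: "nat \<Rightarrow> real mat \<Rightarrow> real vec set \<Rightarrow> bool" where
  "invariant_subspace n A W \<longleftrightarrow>
     VectorSpace.subspace class_ring W (module_vec TYPE(real) n) \<and>
     (\<forall>w\<in>W. A *\<^sub>v w \<in> W)"

definition block_diag :: "nat \<Rightarrow> (nat \<Rightarrow> real mat) \<Rightarrow> real mat" where
  "block_diag m M = diag_block_mat (map M [0..<m])"

(* X is an output of the procedure with prescribed kernel W. The blocks are
   indexed by i < m (instead of 1..m); T' is the inverse of T. The projector Z is
   unique, since an orthogonal projector is determined by its null space. The
   requirements on the blocks A' i exclude no choice of T: they record the claim that
   T^{-1} A T always splits in this way when W is A-invariant. *)
definition obtained_by_procedure ::
    "nat \<Rightarrow> real mat \<Rightarrow> real vec set \<Rightarrow> real mat \<Rightarrow> bool" where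
  "obtained_by_procedure n A W X \<longleftrightarrow>
     (\<exists>Z T T' m d k Z' A' Q' X'.
        orthogonal_projector n Z \<and> mat_kernel Z = W \<and> doubly_stochastic n Z \<and>
        permutation_matrix n T \<and>
        T' \<in> carrier_mat n n \<and> inverts_mat T T' \<and> inverts_mat T' T \<and>
        inj_on k {..<m} \<and>
        (\<forall>i<m. 0 < k i \<and> 0 < d i \<and> k i dvd d i \<and>
               Z' i = diag_block_mat (replicate (d i div k i) (uniform_mat (k i)))) \<and>
        T' * Z * T = block_diag m Z' \<and>
        T' * A * T = block_diag m A' \<and>
        (\<forall>i<m. permutation_matrix (d i) (A' i) \<and> A' i * Z' i = Z' i * A' i) \<and>
        (\<forall>i<m. permutation_matrix (d i) (Q' i) \<and> Q' i * Z' i = Z' i * Q' i \<and>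
               (\<forall>v\<in>mat_range (Z' i).
                  (A' i * Q' i * A' i) *\<^sub>v v = (Q' i * A' i * Q' i) *\<^sub>v v)) \<and>
        (\<forall>i<m. X' i = Z' i * Q' i) \<and>
        X = T * block_diag m X' * T')"

end

theory Submission
  imports Defs
begin

text \<open>
  The equation \<open>AXA = XAX\<close> forces a doubly stochastic \<open>X\<close> to be a projection times a permutation
  matrix, and the reason is a comparison of Frobenius norms. A doubly stochastic matrix is a
  contraction for this norm and a permutation matrix preserves it, so
  \<open>XAX = AXA\<close> has the same norm as \<open>XA\<close>. Multiplying \<open>XA\<close> by the contraction \<open>X\<close> thus loses no norm,
  which is possible only if \<open>XAXX\<^sup>T = XA\<close>. The transposed equation holds for \<open>A\<^sup>T\<close> and \<open>X\<^sup>T\<close> and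
  gives \<open>X\<^sup>TXAX = AX\<close>. Algebra alone then shows that \<open>X\<close> is normal, that
  \<open>Z = X\<^sup>TX = XX\<^sup>T\<close> is an orthogonal projector with \<open>XZ = ZX = X\<close>, and that \<open>Z\<close> commutes with \<open>A\<close>
  (lemma \<open>braid_normal_partial_isometry\<close>). The kernel of \<open>Z\<close> is that of \<open>X\<close>, which is the subspace
  \<open>W\<close> sought.

  The entries of a doubly stochastic projection \<open>Z\<close> are governed by a maximum principle: every column
  of \<open>Z = ZZ\<close> consists of averages of its own entries, hence is constant on its support. So the
  indices fall into classes, and \<open>Z\<close> is \<open>1/k\<close> on a class of size \<open>k\<close> and zero between classes. The matrix \<open>X\<close> is
  constant on pairs of classes and matches each class with one class of the same size; choosing a
  bijection between matched classes produces a permutation matrix \<open>Q\<close> with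
  \<open>X = ZQ = QZ\<close> (lemma \<open>normal_partial_isometry_permutation_times_projection\<close>).

  It remains to bring this into block form. List the indices so that classes of equal size are adjacent and
  each class is contiguous. A permutation matrix commuting with \<open>Z\<close> maps classes to classes
  of the same size, so in the new order \<open>A\<close>, \<open>Q\<close> and \<open>Z\<close> are all block diagonal with one block for
  each class size, and \<open>AXA = XAX\<close> turns into \<open>AQAZ = QAQZ\<close>, read block by block
  (lemma \<open>braid_obtained_by_procedure\<close>).

  For the converse, the blockwise conditions say that \<open>A\<close> and \<open>Q\<close> commute with \<open>Z\<close> and satisfy
  \<open>AQAZ = QAQZ\<close>; inserting \<open>X = ZQ\<close> gives the equation, and \<open>X\<close> and \<open>Z\<close> have the same kernel since
  they differ by an invertible factor (lemma \<open>obtained_by_procedure_sound\<close>).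
\<close>

section \<open>Doubly stochastic matrices and permutation matrices\<close>

lemma mult_entry:
  fixes M N :: "real mat"
  assumes "M \<in> carrier_mat n n" "N \<in> carrier_mat n n" "i < n" "j < n"
  shows "(M * N) $$ (i, j) = (\<Sum>k<n. M $$ (i, k) * N $$ (k, j))"
  using assms by (auto simp: scalar_prod_def atLeast0LessThan intro!: sum.cong)

lemma doubly_stochastic_carrier: "doubly_stochastic n M \<Longrightarrow> M \<in> carrier_mat n n"
  by (simp add: doubly_stochastic_def)

lemma doubly_stochastic_transpose:
  "doubly_stochastic n M \<Longrightarrow> doubly_stochastic n (transpose_mat M)"
  unfolding doubly_stochastic_def by auto

lemma doubly_stochastic_mult:
  assumes "doubly_stochastic n M" "doubly_stochastic n N"
  shows "doubly_stochastic n (M * N)"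
proof -
  have M: "M \<in> carrier_mat n n" and N: "N \<in> carrier_mat n n"
    using assms by (simp_all add: doubly_stochastic_carrier)
  have rows: "(\<Sum>j<n. (M * N) $$ (i, j)) = 1" if i: "i < n" for i
  proof -
    have "(\<Sum>j<n. (M * N) $$ (i, j)) = (\<Sum>j<n. \<Sum>k<n. M $$ (i, k) * N $$ (k, j))"
      using i by (auto intro!: sum.cong simp: mult_entry[OF M N] simp del: index_mult_mat)
    also have "\<dots> = (\<Sum>k<n. M $$ (i, k) * (\<Sum>j<n. N $$ (k, j)))"
      by (subst sum.swap) (simp add: sum_distrib_left)
    also have "\<dots> = 1"
      using assms i by (auto simp: doubly_stochastic_def)
    finally show ?thesis .
  qed
  have cols: "(\<Sum>i<n. (M * N) $$ (i, j)) = 1" if j: "j < n" for j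
  proof -
    have "(\<Sum>i<n. (M * N) $$ (i, j)) = (\<Sum>i<n. \<Sum>k<n. M $$ (i, k) * N $$ (k, j))"
      using j by (auto intro!: sum.cong simp: mult_entry[OF M N] simp del: index_mult_mat)
    also have "\<dots> = (\<Sum>k<n. (\<Sum>i<n. M $$ (i, k)) * N $$ (k, j))"
      by (subst sum.swap) (simp add: sum_distrib_right)
    also have "\<dots> = 1"
      using assms j by (auto simp: doubly_stochastic_def)
    finally show ?thesis .
  qed
  have "0 \<le> (M * N) $$ (i, j)" if "i < n" "j < n" for i j
    using assms that unfolding mult_entry[OF M N that]
    by (auto simp: doubly_stochastic_def intro!: sum_nonneg)
  with rows cols M N show ?thesis
    unfolding doubly_stochastic_def by auto
qed

lemma permutation_matrix_carrier: "permutation_matrix n P \<Longrightarrow> P \<in> carrier_mat n n"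
  by (auto simp: permutation_matrix_def)

lemma permutation_matrixE:
  assumes "permutation_matrix n P"
  obtains \<pi> where "\<pi> permutes {..<n}" and "P = mat n n (\<lambda>(i, j). if i = \<pi> j then 1 else 0)"
  using assms by (auto simp: permutation_matrix_def)

lemma permutation_matrix_transpose:
  assumes "permutation_matrix n P"
  shows "permutation_matrix n (transpose_mat P)"
proof -
  from assms obtain \<pi> where \<pi>: "\<pi> permutes {..<n}"
    and P: "P = mat n n (\<lambda>(i, j). if i = \<pi> j then 1 else 0)" by (rule permutation_matrixE)
  have "transpose_mat P = mat n n (\<lambda>(i, j). if i = inv_into UNIV \<pi> j then 1 else 0)"
    unfolding P using permutes_inverses[OF \<pi>] by (intro eq_matI) auto
  thus ?thesis
    unfolding permutation_matrix_def using permutes_inv[OF \<pi>] by blast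
qed

lemma permutation_matrix_doubly_stochastic:
  assumes "permutation_matrix n P"
  shows "doubly_stochastic n P"
proof -
  have rows: "(\<Sum>j<n. P $$ (i, j)) = 1" if "permutation_matrix n P" "i < n" for i P
  proof -
    from that obtain \<pi> where \<pi>: "\<pi> permutes {..<n}"
      and P: "P = mat n n (\<lambda>(i, j). if i = \<pi> j then 1 else 0)" by (elim permutation_matrixE)
    have "(\<Sum>j<n. P $$ (i, j)) = (\<Sum>j<n. if j = inv_into UNIV \<pi> i then 1 else 0)"
      unfolding P using that permutes_inverses[OF \<pi>] by (intro sum.cong) auto
    also have "\<dots> = 1"
      using that permutes_in_image[OF permutes_inv[OF \<pi>], of i] by auto
    finally show ?thesis .
  qed
  have c: "P \<in> carrier_mat n n" using assms by (rule permutation_matrix_carrier)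
  have "(\<Sum>i<n. P $$ (i, j)) = 1" if "j < n" for j
    using rows[OF permutation_matrix_transpose[OF assms] that] that c by simp
  moreover have "0 \<le> P $$ (i, j)" if "i < n" "j < n" for i j
    using assms that by (auto simp: permutation_matrix_def)
  ultimately show ?thesis
    unfolding doubly_stochastic_def using c rows[OF assms] by auto
qed

lemma permutation_matrix_mult_transpose:
  assumes "permutation_matrix n P"
  shows "P * transpose_mat P = 1\<^sub>m n" "transpose_mat P * P = 1\<^sub>m n"
proof -
  have key: "P * transpose_mat P = 1\<^sub>m n" if "permutation_matrix n P" for P
  proof -
    from that obtain \<pi> where \<pi>: "\<pi> permutes {..<n}"
      and P: "P = mat n n (\<lambda>(i, j). if i = \<pi> j then 1 else 0)" by (rule permutation_matrixE)
    have c: "P \<in> carrier_mat n n" by (simp add: P)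
    show ?thesis
    proof (rule eq_matI)
      fix i j assume ij: "i < dim_row (1\<^sub>m n)" "j < dim_col (1\<^sub>m n)"
      hence "(P * transpose_mat P) $$ (i, j) = (\<Sum>k<n. P $$ (i, k) * P $$ (j, k))"
        using c mult_entry[OF c, of "transpose_mat P" i j] by auto
      also have "\<dots> = (\<Sum>k<n. if k = inv_into UNIV \<pi> i then if i = j then 1 else 0 else 0)"
        using ij permutes_inverses[OF \<pi>] by (intro sum.cong) (auto simp: P)
      also have "\<dots> = 1\<^sub>m n $$ (i, j)"
        using ij permutes_in_image[OF permutes_inv[OF \<pi>], of i] by auto
      finally show "(P * transpose_mat P) $$ (i, j) = 1\<^sub>m n $$ (i, j)" .
    qed (use c in auto)
  qed
  show "P * transpose_mat P = 1\<^sub>m n" by (rule key[OF assms])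
  show "transpose_mat P * P = 1\<^sub>m n"
    using key[OF permutation_matrix_transpose[OF assms]] by simp
qed

section \<open>The Frobenius norm\<close>

definition frobenius_inner :: "real mat \<Rightarrow> real mat \<Rightarrow> real" where
  "frobenius_inner M N = (\<Sum>i<dim_row M. \<Sum>j<dim_col M. M $$ (i, j) * N $$ (i, j))"

abbreviation frobenius_sq :: "real mat \<Rightarrow> real" where
  "frobenius_sq M \<equiv> frobenius_inner M M"

lemma frobenius_sq_transpose: "frobenius_sq (transpose_mat M) = frobenius_sq M"
proof -
  have "frobenius_sq (transpose_mat M)
      = (\<Sum>i<dim_col M. \<Sum>j<dim_row M. M $$ (j, i) * M $$ (j, i))"
    unfolding frobenius_inner_def by (auto intro!: sum.cong)
  also have "\<dots> = frobenius_sq M"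
    unfolding frobenius_inner_def by (rule sum.swap)
  finally show ?thesis .
qed

text \<open>
  Right multiplication by \<open>X\<close> and by its transpose are adjoint.
\<close>

lemma frobenius_inner_mult_right:
  assumes M: "M \<in> carrier_mat n n" and N: "N \<in> carrier_mat n n" and X: "X \<in> carrier_mat n n"
  shows "frobenius_inner M (N * transpose_mat X) = frobenius_inner (M * X) N"
proof -
  have "frobenius_inner M (N * transpose_mat X)
      = (\<Sum>i<n. \<Sum>j<n. \<Sum>k<n. M $$ (i, j) * (N $$ (i, k) * X $$ (j, k)))"
    unfolding frobenius_inner_def using M N X
    by (auto intro!: sum.cong
        simp: mult_entry[OF N transpose_carrier_mat[THEN iffD2, OF X]] sum_distrib_left
        simp del: index_mult_mat)
  also have "\<dots> = (\<Sum>i<n. \<Sum>k<n. \<Sum>j<n. M $$ (i, j) * (N $$ (i, k) * X $$ (j, k)))"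
    by (intro sum.cong refl sum.swap)
  also have "\<dots> = frobenius_inner (M * X) N"
    unfolding frobenius_inner_def using M X
    by (auto intro!: sum.cong simp: mult_entry[OF M X] sum_distrib_right simp del: index_mult_mat(1))
  finally show ?thesis .
qed

text \<open>
  The difference of the two sides is the variance of \<open>c\<close> for the weights \<open>p\<close>.
\<close>

lemma weighted_mean_sq_le:
  fixes p c :: "nat \<Rightarrow> real"
  assumes "\<And>k. k < n \<Longrightarrow> 0 \<le> p k" and "(\<Sum>k<n. p k) = 1"
  shows "(\<Sum>k<n. c k * p k)\<^sup>2 \<le> (\<Sum>k<n. (c k)\<^sup>2 * p k)"
proof -
  define m where "m = (\<Sum>k<n. c k * p k)"
  have "0 \<le> (\<Sum>k<n. p k * (c k - m)\<^sup>2)"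
    using assms(1) by (auto intro!: sum_nonneg)
  also have "\<dots> = (\<Sum>k<n. (c k)\<^sup>2 * p k) - 2 * m * (\<Sum>k<n. c k * p k) + m\<^sup>2 * (\<Sum>k<n. p k)"
    by (simp add: power2_diff algebra_simps sum.distrib sum_subtractf sum_distrib_left
        sum_distrib_right)
  also have "\<dots> = (\<Sum>k<n. (c k)\<^sup>2 * p k) - m\<^sup>2"
    using assms(2) by (simp add: m_def[symmetric] power2_eq_square)
  finally show ?thesis by (simp add: m_def)
qed

text \<open>
  An entry of \<open>M X\<close> is a weighted mean of a row of \<open>M\<close>, since the columns of \<open>X\<close> sum to one; after
  Jensen's inequality the row sums of \<open>X\<close> collapse the weights.
\<close>

lemma frobenius_sq_mult_doubly_stochastic_le:
  assumes M: "M \<in> carrier_mat n n" and X: "doubly_stochastic n X"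
  shows "frobenius_sq (M * X) \<le> frobenius_sq M"
proof -
  have Xc: "X \<in> carrier_mat n n" using X by (rule doubly_stochastic_carrier)
  have "frobenius_sq (M * X) = (\<Sum>i<n. \<Sum>j<n. (\<Sum>k<n. M $$ (i, k) * X $$ (k, j))\<^sup>2)"
    unfolding frobenius_inner_def using M Xc
    by (auto intro!: sum.cong simp: mult_entry[OF M Xc] power2_eq_square simp del: index_mult_mat(1))
  also have "\<dots> \<le> (\<Sum>i<n. \<Sum>j<n. \<Sum>k<n. (M $$ (i, k))\<^sup>2 * X $$ (k, j))"
    using X by (intro sum_mono weighted_mean_sq_le) (auto simp: doubly_stochastic_def)
  also have "\<dots> = (\<Sum>i<n. \<Sum>k<n. (M $$ (i, k))\<^sup>2 * (\<Sum>j<n. X $$ (k, j)))"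
    by (simp add: sum_distrib_left) (intro sum.cong refl sum.swap)
  also have "\<dots> = frobenius_sq M"
    using X M unfolding frobenius_inner_def
    by (auto intro!: sum.cong simp: doubly_stochastic_def power2_eq_square)
  finally show ?thesis .
qed

text \<open>
  The equality case of the contraction bound. With \<open>N = M X X\<^sup>T\<close>, adjointness makes the inner product of
  \<open>M\<close> and \<open>N\<close> equal to the squared norm of \<open>M X\<close>, so the squared distance of \<open>M\<close> and \<open>N\<close> is at
  most \<open>|M|\<^sup>2 - 2 |M|\<^sup>2 + |M|\<^sup>2 = 0\<close>.
\<close>

lemma mult_transpose_eq_if_frobenius_sq_eq:
  assumes M: "M \<in> carrier_mat n n" and X: "doubly_stochastic n X"
    and eq: "frobenius_sq (M * X) = frobenius_sq M"
  shows "M * X * transpose_mat X = M"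
proof -
  have Xc: "X \<in> carrier_mat n n" using X by (rule doubly_stochastic_carrier)
  define N where "N = M * X * transpose_mat X"
  have N: "N \<in> carrier_mat n n" unfolding N_def using M Xc by auto
  have MN: "frobenius_inner M N = frobenius_sq (M * X)"
    unfolding N_def by (rule frobenius_inner_mult_right[OF M _ Xc]) (use M Xc in auto)
  have NN: "frobenius_sq N \<le> frobenius_sq M"
    using frobenius_sq_mult_doubly_stochastic_le[OF _ doubly_stochastic_transpose[OF X], of "M * X"]
      eq M Xc by (auto simp: N_def)
  have "(\<Sum>i<n. \<Sum>j<n. (M $$ (i, j) - N $$ (i, j))\<^sup>2)
      = frobenius_sq M - 2 * frobenius_inner M N + frobenius_sq N"
    unfolding frobenius_inner_def using M N
    by (simp add: power2_diff sum.distrib sum_subtractf sum_distrib_left power2_eq_square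
        algebra_simps)
  also have "\<dots> \<le> 0" using MN NN eq by simp
  finally have le: "(\<Sum>i<n. \<Sum>j<n. (M $$ (i, j) - N $$ (i, j))\<^sup>2) \<le> 0" .
  have "(\<Sum>i<n. \<Sum>j<n. (M $$ (i, j) - N $$ (i, j))\<^sup>2) = 0"
    by (intro antisym le sum_nonneg) auto
  hence "M $$ (i, j) - N $$ (i, j) = 0" if "i < n" "j < n" for i j
    using that by (simp add: sum_nonneg_eq_0_iff sum_nonneg)
  hence "N = M" using M N by (intro eq_matI) auto
  thus ?thesis by (simp add: N_def)
qed

text \<open>
  A permutation matrix and its inverse are both contractions.
\<close>

lemma frobenius_sq_mult_permutation:
  assumes M: "M \<in> carrier_mat n n" and P: "permutation_matrix n P"
  shows "frobenius_sq (M * P) = frobenius_sq M"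
proof (rule antisym)
  have Pc: "P \<in> carrier_mat n n" using P by (rule permutation_matrix_carrier)
  show "frobenius_sq (M * P) \<le> frobenius_sq M"
    by (intro frobenius_sq_mult_doubly_stochastic_le[OF M] permutation_matrix_doubly_stochastic P)
  have "M = M * P * transpose_mat P"
    using M Pc permutation_matrix_mult_transpose[OF P] by (simp add: assoc_mult_mat[of _ n n _ n _ n])
  also have "frobenius_sq \<dots> \<le> frobenius_sq (M * P)"
    by (rule frobenius_sq_mult_doubly_stochastic_le)
      (use M Pc P in \<open>auto intro!: permutation_matrix_doubly_stochastic permutation_matrix_transpose\<close>)
  finally show "frobenius_sq M \<le> frobenius_sq (M * P)" .
qed

lemma frobenius_sq_permutation_mult:
  assumes M: "M \<in> carrier_mat n n" and P: "permutation_matrix n P"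
  shows "frobenius_sq (P * M) = frobenius_sq M"
proof -
  have Pc: "P \<in> carrier_mat n n" using P by (rule permutation_matrix_carrier)
  have "frobenius_sq (P * M) = frobenius_sq (transpose_mat M * transpose_mat P)"
    using frobenius_sq_transpose[of "P * M"] M Pc by (simp add: transpose_mult[of _ n n])
  also have "\<dots> = frobenius_sq M"
    using frobenius_sq_mult_permutation[of "transpose_mat M" n "transpose_mat P"] M
      permutation_matrix_transpose[OF P] by (simp add: frobenius_sq_transpose)
  finally show ?thesis .
qed

section \<open>The equation AXA = XAX\<close>

text \<open>
  Permutation matrices preserve the norm, so \<open>(XA)X = AXA\<close> has the norm of \<open>X A\<close>: this is
  the equality case for \<open>M = X A\<close>.
\<close>

lemma braid_absorbs_right:
  assumes A: "permutation_matrix n A" and X: "doubly_stochastic n X"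
    and braid: "A * X * A = X * A * X"
  shows "X * A * X * transpose_mat X = X * A"
proof (rule mult_transpose_eq_if_frobenius_sq_eq[OF _ X])
  have Ac: "A \<in> carrier_mat n n" using A by (rule permutation_matrix_carrier)
  have Xc: "X \<in> carrier_mat n n" using X by (rule doubly_stochastic_carrier)
  show "X * A \<in> carrier_mat n n" using Ac Xc by auto
  have "frobenius_sq (A * X * A) = frobenius_sq (X * A)"
    using Ac Xc by (simp add: frobenius_sq_mult_permutation[OF _ A]
        frobenius_sq_permutation_mult[OF _ A])
  thus "frobenius_sq (X * A * X) = frobenius_sq (X * A)" by (simp add: braid)
qed

text \<open>
  Transposition turns a solution of the equation into another one, which makes every consequence
  available in a mirrored form.
\<close>

lemma braid_transpose:
  assumes Ac: "A \<in> carrier_mat n n" and Xc: "X \<in> carrier_mat n n"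
    and braid: "A * X * A = X * A * (X :: real mat)"
  shows "transpose_mat A * transpose_mat X * transpose_mat A
    = transpose_mat X * transpose_mat A * transpose_mat X"
proof -
  have "transpose_mat A * transpose_mat X * transpose_mat A = transpose_mat (A * X * A)"
    using Ac Xc by (simp add: transpose_mult[of _ n n _ n] assoc_mult_mat[of _ n n _ n _ n])
  also have "\<dots> = transpose_mat X * transpose_mat A * transpose_mat X"
    unfolding braid using Ac Xc
    by (simp add: transpose_mult[of _ n n _ n] assoc_mult_mat[of _ n n _ n _ n])
  finally show ?thesis .
qed

lemma braid_absorbs_left:
  assumes A: "permutation_matrix n A" and X: "doubly_stochastic n X"
    and braid: "A * X * A = X * A * X"
  shows "transpose_mat X * X * A * X = A * X"
proof -
  have Ac: "A \<in> carrier_mat n n" using A by (rule permutation_matrix_carrier)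
  have Xc: "X \<in> carrier_mat n n" using X by (rule doubly_stochastic_carrier)
  have "transpose_mat (transpose_mat X * transpose_mat A * transpose_mat X * X)
      = transpose_mat (transpose_mat X * transpose_mat A)"
    using braid_absorbs_right[OF permutation_matrix_transpose[OF A] doubly_stochastic_transpose[OF X]
        braid_transpose[OF Ac Xc braid]] by simp
  thus ?thesis
    using Ac Xc by (simp add: transpose_mult[of _ n n _ n] assoc_mult_mat[of _ n n _ n _ n])
qed

text \<open>
  By \<open>braid_absorbs_right\<close>, the matrix \<open>X A\<close> absorbs \<open>XX\<^sup>T\<close> on its right. So does \<open>X\<close>, because the
  mirrored identity \<open>braid_absorbs_left\<close> and the equation make \<open>X\<close> a left multiple of \<open>X A\<close>.
\<close>

lemma braid_mult_range_projector:
  assumes A: "permutation_matrix n A" and X: "doubly_stochastic n X"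
    and braid: "A * X * A = X * A * X"
  shows "X * (X * transpose_mat X) = X"
proof -
  have Ac[simp]: "A \<in> carrier_mat n n" using A by (rule permutation_matrix_carrier)
  have Xc[simp]: "X \<in> carrier_mat n n" using X by (rule doubly_stochastic_carrier)
  note assoc = assoc_mult_mat[of _ n n _ n _ n] mult_carrier_mat[of _ n n _ n]
  \<comment> \<open>The left factor in \<open>X = L (X A)\<close>.\<close>
  define L where "L = transpose_mat A * transpose_mat X * A"
  have L[simp]: "L \<in> carrier_mat n n" unfolding L_def by (intro mult_carrier_mat[of _ n n]) simp_all
  have "X = transpose_mat A * A * X"
    by (simp add: permutation_matrix_mult_transpose[OF A] left_mult_one_mat[OF Xc])
  also have "\<dots> = transpose_mat A * (A * X)" by (simp add: assoc)
  also have "A * X = transpose_mat X * (X * A * X)"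
    using braid_absorbs_left[OF A X braid] by (simp add: assoc)
  also have "X * A * X = A * X * A" by (rule braid[symmetric])
  finally have X_eq: "X = L * (X * A)" by (simp add: L_def assoc)
  have "X * (X * transpose_mat X) = L * (X * A * X * transpose_mat X)"
    by (subst (1) X_eq) (simp add: assoc)
  also have "\<dots> = X" using braid_absorbs_right[OF A X braid] X_eq by simp
  finally show ?thesis .
qed

text \<open>
  From \<open>XXX\<^sup>T = X\<close> and its mirror image \<open>X\<^sup>TX\<^sup>TX = X\<^sup>T\<close>, both \<open>XX\<^sup>T\<close> and \<open>X\<^sup>TX\<close> equal
  \<open>XX\<^sup>TX\<^sup>TX\<close>. The commutation with \<open>A\<close> comes from computing \<open>ZAZ\<close> in two ways, by absorbing \<open>Z\<close>
  on the left or on the right.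
\<close>

lemma braid_normal_partial_isometry:
  fixes A X :: "real mat"
  assumes A: "permutation_matrix n A" and X: "doubly_stochastic n X"
    and braid: "A * X * A = X * A * X"
  defines "Z \<equiv> transpose_mat X * X"
  shows "X * transpose_mat X = Z" and "X * Z = X" and "Z * X = X" and "Z * Z = Z"
    and "A * Z = Z * A"
proof -
  have Ac[simp]: "A \<in> carrier_mat n n" using A by (rule permutation_matrix_carrier)
  have Xc[simp]: "X \<in> carrier_mat n n" using X by (rule doubly_stochastic_carrier)
  note assoc = assoc_mult_mat[of _ n n _ n _ n] mult_carrier_mat[of _ n n _ n]
  let ?Y = "transpose_mat X"
  have fact1: "X * (X * ?Y) = X" by (rule braid_mult_range_projector[OF A X braid])
  have fact2: "?Y * (?Y * X) = ?Y"
    using braid_mult_range_projector[OF permutation_matrix_transpose[OF A]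
        doubly_stochastic_transpose[OF X] braid_transpose[OF Ac Xc braid]] by simp
  have fact3: "X * ?Y * ?Y = ?Y"
    using arg_cong[OF fact1, of transpose_mat]
    by (simp add: transpose_mult[of _ n n _ n] mult_carrier_mat[of _ n n _ n])
  have "X * ?Y = X * (?Y * (?Y * X))" by (simp add: fact2)
  also have "\<dots> = X * ?Y * ?Y * X" by (simp add: assoc)
  also have "\<dots> = Z" by (simp add: fact3 Z_def)
  finally show XY: "X * ?Y = Z" .
  show XZ: "X * Z = X" using fact1 by (simp add: XY)
  have Zc[simp]: "Z \<in> carrier_mat n n" by (simp add: Z_def assoc)
  have "Z * X = X * ?Y * X" by (simp add: XY)
  also have "\<dots> = X * Z" by (simp add: Z_def assoc)
  finally have "Z * X = X * Z" .
  thus "Z * X = X" by (simp add: XZ)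
  have "Z * Z = ?Y * (X * Z)" by (simp add: Z_def assoc)
  thus "Z * Z = Z" by (simp add: XZ) (simp add: Z_def)
  have "Z * A * Z = Z * (A * X) * ?Y" by (simp add: XY[symmetric] assoc)
  also have "Z * (A * X) = A * X"
    using braid_absorbs_left[OF A X braid] by (simp add: Z_def assoc)
  finally have AZ: "Z * A * Z = A * Z" by (simp add: XY[symmetric] assoc)
  have "Z * A * Z = ?Y * (X * A * X * ?Y)" by (simp add: XY assoc) (simp add: Z_def assoc)
  also have "X * A * X * ?Y = X * A" by (rule braid_absorbs_right[OF A X braid])
  finally have "Z * A * Z = Z * A" by (simp add: Z_def assoc)
  with AZ show "A * Z = Z * A" by simp
qed

lemma mat_kernel_subspace:
  fixes M :: "real mat"
  assumes M: "M \<in> carrier_mat n n"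
  shows "VectorSpace.subspace class_ring (mat_kernel M) (module_vec TYPE(real) n)"
proof -
  interpret vec_space "TYPE(real)" n .
  show ?thesis
    by unfold_locales
      (use M in \<open>auto simp: mat_kernel[OF M] module_vec_simps class_ring_simps
        mult_add_distrib_mat_vec[OF M] mult_mat_vec[OF M]\<close>)
qed

text \<open>
  The equation factors \<open>X A\<close> as \<open>(A\<^sup>TXA) X\<close>, so whatever \<open>X\<close> kills is killed by \<open>X A\<close>.
\<close>

lemma braid_invariant_subspace:
  assumes A: "permutation_matrix n A" and X: "doubly_stochastic n X"
    and braid: "A * X * A = X * A * X"
  shows "invariant_subspace n A (mat_kernel X)"
proof -
  have Ac[simp]: "A \<in> carrier_mat n n" using A by (rule permutation_matrix_carrier)
  have Xc[simp]: "X \<in> carrier_mat n n" using X by (rule doubly_stochastic_carrier)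
  note assoc = assoc_mult_mat[of _ n n _ n _ n] mult_carrier_mat[of _ n n _ n]
  have XA: "X * A = transpose_mat A * X * A * X"
  proof -
    have "X * A = transpose_mat A * (A * X * A)"
      using permutation_matrix_mult_transpose(2)[OF A]
      by (simp add: assoc_mult_mat[of _ n n _ n _ n, symmetric] mult_carrier_mat[of _ n n _ n] left_mult_one_mat[OF Xc])
    also have "\<dots> = transpose_mat A * (X * A * X)" by (simp only: braid)
    also have "\<dots> = transpose_mat A * X * A * X" by (simp add: assoc)
    finally show ?thesis .
  qed
  have "A *\<^sub>v w \<in> mat_kernel X" if w: "w \<in> mat_kernel X" for w
  proof -
    note w' = mat_kernelD[OF Xc w]
    have "transpose_mat A * X * A \<in> carrier_mat n n" by (simp add: assoc)
    hence "w \<in> mat_kernel (X * A)"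
      using mat_kernel_mult_subset[OF Xc] w unfolding XA by blast
    hence "X * A *\<^sub>v w = 0\<^sub>v n" using mat_kernelD(2)[of "X * A" n n] by (simp add: assoc)
    thus ?thesis using w'
      by (intro mat_kernelI[OF Xc])
        (simp_all add: assoc_mult_mat_vec[OF Xc Ac] mult_mat_vec_carrier[OF Ac])
  qed
  thus ?thesis
    unfolding invariant_subspace_def using mat_kernel_subspace[OF Xc] by blast
qed

section \<open>Doubly stochastic projections\<close>

definition doubly_stochastic_projection :: "nat \<Rightarrow> real mat \<Rightarrow> bool" where
  "doubly_stochastic_projection n Z \<longleftrightarrow> orthogonal_projector n Z \<and> doubly_stochastic n Z"

text \<open>
  For a doubly stochastic projection these sets are the classes of an equivalence relation on the
  indices below \<open>n\<close>.
\<close>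

definition support_class :: "nat \<Rightarrow> real mat \<Rightarrow> nat \<Rightarrow> nat set" where
  "support_class n Z j = {i. i < n \<and> 0 < Z $$ (i, j)}"

context
  fixes n :: nat and Z :: "real mat"
  assumes Z: "doubly_stochastic_projection n Z"
begin

lemma ds_projection_carrier: "Z \<in> carrier_mat n n"
  using Z by (simp add: doubly_stochastic_projection_def orthogonal_projector_def)

lemma ds_projection_nonneg: "i < n \<Longrightarrow> j < n \<Longrightarrow> 0 \<le> Z $$ (i, j)"
  using Z by (simp add: doubly_stochastic_projection_def doubly_stochastic_def)

lemma ds_projection_row_sum: "i < n \<Longrightarrow> (\<Sum>j<n. Z $$ (i, j)) = 1"
  using Z by (simp add: doubly_stochastic_projection_def doubly_stochastic_def)

lemma ds_projection_col_sum: "j < n \<Longrightarrow> (\<Sum>i<n. Z $$ (i, j)) = 1"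
  using Z by (simp add: doubly_stochastic_projection_def doubly_stochastic_def)

lemma ds_projection_sym:
  assumes "i < n" "j < n" shows "Z $$ (i, j) = Z $$ (j, i)"
proof -
  have "transpose_mat Z = Z"
    using Z by (simp add: doubly_stochastic_projection_def orthogonal_projector_def)
  thus ?thesis using assms ds_projection_carrier index_transpose_mat(1)[of j Z i] by auto
qed

lemma ds_projection_entry:
  assumes "i < n" "j < n" shows "Z $$ (i, j) = (\<Sum>k<n. Z $$ (i, k) * Z $$ (k, j))"
proof -
  have "Z * Z = Z"
    using Z by (simp add: doubly_stochastic_projection_def orthogonal_projector_def)
  thus ?thesis using mult_entry[OF ds_projection_carrier ds_projection_carrier assms] by simp
qed

text \<open>
  Maximum principle: since \<open>Z = ZZ\<close> and the rows sum to one, the entry \<open>Z (m, j)\<close> is the mean of column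
  \<open>j\<close> with the weights of row \<open>m\<close>. A mean that equals the maximum forces equality wherever the weight
  is positive.
\<close>

lemma ds_projection_eq_column_maximum:
  assumes m: "m < n" and j: "j < n" and k: "k < n"
    and max: "\<And>i. i < n \<Longrightarrow> Z $$ (i, j) \<le> Z $$ (m, j)"
    and pos: "0 < Z $$ (m, k)"
  shows "Z $$ (k, j) = Z $$ (m, j)"
proof -
  have "(\<Sum>l<n. Z $$ (m, l) * (Z $$ (m, j) - Z $$ (l, j)))
      = (\<Sum>l<n. Z $$ (m, l)) * Z $$ (m, j) - (\<Sum>l<n. Z $$ (m, l) * Z $$ (l, j))"
    by (simp add: algebra_simps sum_subtractf sum_distrib_left sum_distrib_right)
  also have "\<dots> = 0"
    using ds_projection_entry[OF m j] ds_projection_row_sum[OF m] by simp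
  finally have "\<forall>l\<in>{..<n}. Z $$ (m, l) * (Z $$ (m, j) - Z $$ (l, j)) = 0"
    using max m ds_projection_nonneg by (subst (asm) sum_nonneg_eq_0_iff) auto
  hence "Z $$ (m, k) * (Z $$ (m, j) - Z $$ (k, j)) = 0" using k by blast
  thus ?thesis using pos by simp
qed

text \<open>
  A column maximum is positive and, by the maximum principle applied with \<open>k = j\<close>, is also attained
  on the diagonal.
\<close>

lemma ds_projection_le_diag_and_diag_pos:
  assumes i: "i < n" and j: "j < n"
  shows "Z $$ (i, j) \<le> Z $$ (j, j)" "0 < Z $$ (j, j)"
proof -
  have "\<exists>m\<in>{..<n}. \<forall>i\<in>{..<n}. Z $$ (i, j) \<le> Z $$ (m, j)"
    using obtains_MAX[of "{..<n}" "\<lambda>i. Z $$ (i, j)"] i by (metis Max_ge finite_imageI finite_lessThan imageI lessThan_iff empty_iff)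
  then obtain m where m: "m < n" and max: "\<And>i. i < n \<Longrightarrow> Z $$ (i, j) \<le> Z $$ (m, j)"
    by auto
  have pos: "0 < Z $$ (m, j)"
  proof (rule ccontr)
    assume "\<not> 0 < Z $$ (m, j)"
    hence "(\<Sum>i<n. Z $$ (i, j)) \<le> 0"
      using max by (intro sum_nonpos) fastforce
    thus False using ds_projection_col_sum[OF j] by simp
  qed
  have "Z $$ (j, j) = Z $$ (m, j)"
    by (rule ds_projection_eq_column_maximum[OF m j j max pos])
  thus "Z $$ (i, j) \<le> Z $$ (j, j)" "0 < Z $$ (j, j)" using max i pos by auto
qed

lemma ds_projection_eq_diag:
  assumes i: "i < n" and j: "j < n" and pos: "0 < Z $$ (i, j)"
  shows "Z $$ (i, j) = Z $$ (j, j)"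
  by (rule ds_projection_eq_column_maximum[OF j j i]) (use assms ds_projection_le_diag_and_diag_pos ds_projection_sym in auto)

text \<open>
  Positivity is transitive because \<open>Z = ZZ\<close> has nonnegative entries, and by the previous lemma the positive
  entries of a column are all equal; so indices of one class have identical rows.
\<close>

lemma ds_projection_row_cong:
  assumes i: "i < n" and j: "j < n" and k: "k < n" and pos: "0 < Z $$ (i, j)"
  shows "Z $$ (i, k) = Z $$ (j, k)"
proof -
  have trans: "0 < Z $$ (a, k)" if "a < n" "b < n" "0 < Z $$ (a, b)" "0 < Z $$ (b, k)" for a b
  proof -
    have "0 < Z $$ (a, b) * Z $$ (b, k)" using that by simp
    also have "\<dots> \<le> (\<Sum>l<n. Z $$ (a, l) * Z $$ (l, k))"
      by (rule member_le_sum) (use that k ds_projection_nonneg in auto)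
    finally show ?thesis using ds_projection_entry[OF \<open>a < n\<close> k] by simp
  qed
  have "0 < Z $$ (i, k) \<longleftrightarrow> 0 < Z $$ (j, k)"
    using trans[OF i j pos] trans[OF j i] pos ds_projection_sym[OF i j] by auto
  thus ?thesis
    using ds_projection_eq_diag[OF i k] ds_projection_eq_diag[OF j k] ds_projection_nonneg[OF i k] ds_projection_nonneg[OF j k]
    by linarith
qed

lemma support_class_self: "j < n \<Longrightarrow> j \<in> support_class n Z j"
  by (simp add: support_class_def ds_projection_le_diag_and_diag_pos)

lemma support_class_cong:
  assumes "i < n" "j < n" "0 < Z $$ (i, j)"
  shows "support_class n Z i = support_class n Z j"
  using ds_projection_row_cong[OF assms(1,2) _ assms(3)] assms ds_projection_sym
  unfolding support_class_def by auto

lemma support_class_disjoint: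
  assumes i: "i < n" and j: "j < n" and "support_class n Z i \<noteq> support_class n Z j"
  shows "support_class n Z i \<inter> support_class n Z j = {}"
proof (rule ccontr)
  assume "support_class n Z i \<inter> support_class n Z j \<noteq> {}"
  then obtain k where "k < n" "0 < Z $$ (k, i)" "0 < Z $$ (k, j)"
    by (auto simp: support_class_def)
  with support_class_cong i j assms(3) show False by metis
qed

lemma finite_support_class [simp]: "finite (support_class n Z j)"
  by (simp add: support_class_def)

lemma ds_projection_diag_times_card:
  assumes j: "j < n"
  shows "Z $$ (j, j) * card (support_class n Z j) = 1"
proof -
  have "1 = (\<Sum>i<n. Z $$ (i, j))" using ds_projection_col_sum[OF j] by simp
  also have "\<dots> = (\<Sum>i\<in>support_class n Z j. Z $$ (i, j))"
    using ds_projection_nonneg j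
    by (intro sum.mono_neutral_right) (auto simp: support_class_def order_less_le)
  also have "\<dots> = (\<Sum>i\<in>support_class n Z j. Z $$ (j, j))"
    using ds_projection_eq_diag j by (intro sum.cong) (auto simp: support_class_def)
  finally show ?thesis by (simp add: mult.commute)
qed

lemma ds_projection_diag_eq_inverse_card:
  "j < n \<Longrightarrow> Z $$ (j, j) = 1 / card (support_class n Z j)"
  using ds_projection_diag_times_card[of j]
  by (cases "card (support_class n Z j) = 0") (auto simp: eq_divide_eq)

end

text \<open>
  The Gram identities \<open>X\<^sup>TX = Z = XX\<^sup>T\<close> say that positive entries of \<open>X\<close> in one row, or in one column, have
  indices in the same class, while \<open>XZ = ZX = X\<close> makes \<open>X\<close> constant on pairs of classes. Hence the
  support of column \<open>j\<close> is a full class, with constant value \<open>Z (j, j)\<close>, and therefore as large as the class of \<open>j\<close>.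
  The permutation maps each class by a bijection onto that support.
\<close>

lemma normal_partial_isometry_permutation_times_projection:
  fixes X :: "real mat"
  assumes X: "doubly_stochastic n X"
    and normal: "X * transpose_mat X = transpose_mat X * X"
    and isometry: "X * (transpose_mat X * X) = X"
  defines "Z \<equiv> transpose_mat X * X"
  obtains Q where "permutation_matrix n Q" "Q * Z = X" "Z * Q = X"
proof -
  have Xc[simp]: "X \<in> carrier_mat n n" using X by (rule doubly_stochastic_carrier)
  have Yc: "transpose_mat X \<in> carrier_mat n n" by simp
  note assoc = assoc_mult_mat[of _ n n _ n _ n] mult_carrier_mat[of _ n n _ n]
  have Zc[simp]: "Z \<in> carrier_mat n n" by (simp add: Z_def assoc)
  have XZ: "X * Z = X" using isometry by (simp add: Z_def)
  have ZX: "Z * X = X" using isometry by (simp add: Z_def normal[symmetric] assoc)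
  have Zt: "transpose_mat Z = Z" by (simp add: Z_def transpose_mult[of _ n n _ n])
  have "Z * Z = transpose_mat X * (X * Z)" unfolding Z_def by (simp add: assoc)
  hence ZZ: "Z * Z = Z" by (simp add: XZ) (simp add: Z_def)
  have "doubly_stochastic n Z"
    unfolding Z_def using X by (intro doubly_stochastic_mult doubly_stochastic_transpose)
  with ZZ Zt have proj: "doubly_stochastic_projection n Z"
    by (simp add: doubly_stochastic_projection_def orthogonal_projector_def)

  have nn: "0 \<le> X $$ (i, j)" if "i < n" "j < n" for i j
    using X that by (simp add: doubly_stochastic_def)
  have col_Z: "Z $$ (j, l) = (\<Sum>i<n. X $$ (i, j) * X $$ (i, l))" if "j < n" "l < n" for j l
    using mult_entry[OF Yc Xc that] that Xc by (simp add: Z_def del: index_mult_mat)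
  have row_Z: "Z $$ (j, l) = (\<Sum>i<n. X $$ (j, i) * X $$ (l, i))" if "j < n" "l < n" for j l
    using mult_entry[OF Xc Yc that] that Xc by (simp add: Z_def normal del: index_mult_mat)
  have same_row: "0 < Z $$ (j, l)"
    if "i < n" "j < n" "l < n" "0 < X $$ (i, j)" "0 < X $$ (i, l)" for i j l
  proof -
    have "0 < X $$ (i, j) * X $$ (i, l)" using that by simp
    also have "\<dots> \<le> Z $$ (j, l)" unfolding col_Z[OF that(2,3)]
      by (rule member_le_sum) (use that nn in auto)
    finally show ?thesis .
  qed
  have same_col: "0 < Z $$ (j, l)"
    if "i < n" "j < n" "l < n" "0 < X $$ (j, i)" "0 < X $$ (l, i)" for i j l
  proof -
    have "0 < X $$ (j, i) * X $$ (l, i)" using that by simp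
    also have "\<dots> \<le> Z $$ (j, l)" unfolding row_Z[OF that(2,3)]
      by (rule member_le_sum) (use that nn in auto)
    finally show ?thesis .
  qed
  have row_cong: "X $$ (i, j) = X $$ (l, j)" if "i < n" "l < n" "j < n" "0 < Z $$ (i, l)" for i l j
  proof -
    have expand: "X $$ (a, j) = (\<Sum>k<n. Z $$ (a, k) * X $$ (k, j))" if "a < n" for a
      using mult_entry[OF Zc Xc that \<open>j < n\<close>] unfolding ZX .
    show ?thesis
      unfolding expand[OF that(1)] expand[OF that(2)]
      by (intro sum.cong refl arg_cong2[where f = "(*)"] ds_projection_row_cong[OF proj that(1,2) _ that(4)])
        simp
  qed
  have col_cong: "X $$ (i, j) = X $$ (i, l)" if "i < n" "l < n" "j < n" "0 < Z $$ (j, l)" for i l j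
  proof -
    have expand: "X $$ (i, a) = (\<Sum>k<n. X $$ (i, k) * Z $$ (a, k))" if a: "a < n" for a
    proof -
      have "X $$ (i, a) = (\<Sum>k<n. X $$ (i, k) * Z $$ (k, a))"
        using mult_entry[OF Xc Zc \<open>i < n\<close> a] unfolding XZ .
      also have "\<dots> = (\<Sum>k<n. X $$ (i, k) * Z $$ (a, k))"
        by (intro sum.cong refl arg_cong2[where f = "(*)"] ds_projection_sym[OF proj _ a]) simp
      finally show ?thesis .
    qed
    show ?thesis
      unfolding expand[OF that(3)] expand[OF that(2)]
      by (intro sum.cong refl arg_cong2[where f = "(*)"] ds_projection_row_cong[OF proj that(3,2) _ that(4)])
        simp
  qed
  \<comment> \<open>The entries of column \<open>j\<close> sum to one, their squares to \<open>Z (j, j)\<close>, and the positive ones are equal.\<close>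
  have positive_entry: "X $$ (i, j) = Z $$ (j, j)" if ij: "i < n" "j < n" "0 < X $$ (i, j)" for i j
  proof -
    have square: "X $$ (k, j) * X $$ (k, j) = X $$ (i, j) * X $$ (k, j)" if "k < n" for k
    proof (cases "X $$ (k, j) = 0")
      case False
      hence "0 < X $$ (k, j)" using nn[OF that ij(2)] by simp
      thus ?thesis using row_cong[OF ij(1) that ij(2) same_col[OF ij(2,1) that ij(3)]] by simp
    qed simp
    have "Z $$ (j, j) = X $$ (i, j) * (\<Sum>k<n. X $$ (k, j))"
      unfolding col_Z[OF ij(2,2)] sum_distrib_left
      by (intro sum.cong refl square) simp
    thus ?thesis using X ij by (simp add: doubly_stochastic_def)
  qed

  define supp where "supp j = {i. i < n \<and> 0 < X $$ (i, j)}" for j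
  have card_supp: "card (supp j) = card (support_class n Z j)" if j: "j < n" for j
  proof -
    have "1 = (\<Sum>i<n. X $$ (i, j))" using X j by (simp add: doubly_stochastic_def)
    also have "\<dots> = (\<Sum>i\<in>supp j. X $$ (i, j))"
      using nn j by (intro sum.mono_neutral_right) (auto simp: supp_def order_less_le)
    also have "\<dots> = (\<Sum>i\<in>supp j. Z $$ (j, j))"
      using positive_entry j by (intro sum.cong) (auto simp: supp_def)
    finally have "Z $$ (j, j) * card (supp j) = Z $$ (j, j) * card (support_class n Z j)"
      using ds_projection_diag_times_card[OF proj j] by (simp add: mult.commute)
    thus ?thesis using ds_projection_le_diag_and_diag_pos(2)[OF proj j j] by simp
  qed
  \<comment> \<open>A choice that depends on \<open>j\<close> only through its class, so that indices of one class share a bijection.\<close>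
  define g where "g j = (SOME f. bij_betw f (support_class n Z j) (supp j))" for j
  have g: "bij_betw (g j) (support_class n Z j) (supp j)" if "j < n" for j
  proof -
    have "\<exists>f. bij_betw f (support_class n Z j) (supp j)"
      by (rule finite_same_card_bij) (use proj card_supp[OF that] in \<open>auto simp: supp_def\<close>)
    thus ?thesis unfolding g_def by (rule someI_ex)
  qed
  have g_cong: "g j = g l" if "j < n" "l < n" "0 < Z $$ (j, l)" for j l
  proof -
    have "supp j = supp l" using col_cong[OF _ that(2,1,3)] by (auto simp: supp_def)
    thus ?thesis by (simp add: g_def support_class_cong[OF proj that])
  qed
  define \<sigma> where "\<sigma> j = (if j < n then g j j else j)" for j
  have \<sigma>_supp: "\<sigma> j < n" "0 < X $$ (\<sigma> j, j)" if "j < n" for j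
    using bij_betwE[OF g[OF that]] support_class_self[OF proj that] that
    by (auto simp: \<sigma>_def supp_def)
  have perm: "\<sigma> permutes {..<n}"
  proof (rule inj_imp_permutes)
    show "inj_on \<sigma> {..<n}"
    proof (rule inj_onI)
      fix j l assume jl: "j \<in> {..<n}" "l \<in> {..<n}" and eq: "\<sigma> j = \<sigma> l"
      hence Zjl: "0 < Z $$ (j, l)"
        using same_row[of "\<sigma> j" j l] \<sigma>_supp[of j] \<sigma>_supp[of l] by auto
      hence "l \<in> support_class n Z j" "j \<in> support_class n Z j"
        using jl ds_projection_sym[OF proj, of j l] support_class_self[OF proj]
        by (auto simp: support_class_def)
      moreover have "g j j = g j l" using eq jl g_cong[of j l] Zjl by (auto simp: \<sigma>_def)
      ultimately show "j = l"
        using bij_betw_imp_inj_on[OF g] jl by (auto dest: inj_onD)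
    qed
  qed (use \<sigma>_supp in \<open>auto simp: \<sigma>_def\<close>)
  define Q :: "real mat" where "Q = mat n n (\<lambda>(i, j). if i = \<sigma> j then 1 else 0)"
  have Q: "permutation_matrix n Q" using perm by (auto simp: permutation_matrix_def Q_def)
  have Qc[simp]: "Q \<in> carrier_mat n n" by (simp add: Q_def)
  have QZ: "Q * Z = X"
  proof (rule eq_matI)
    fix i j assume "i < dim_row X" "j < dim_col X"
    hence i: "i < n" and j: "j < n" using Xc by auto
    obtain l where l: "l < n" "i = \<sigma> l"
      using permutes_image[OF perm] i by (metis imageE lessThan_iff)
    have "(Q * Z) $$ (i, j) = (\<Sum>k<n. Q $$ (i, k) * Z $$ (k, j))"
      by (rule mult_entry[OF Qc Zc i j])
    also have "\<dots> = (\<Sum>k<n. if k = l then Z $$ (l, j) else 0)"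
      using i l permutes_inj[OF perm] by (intro sum.cong) (auto simp: Q_def inj_eq)
    also have "\<dots> = Z $$ (l, j)" using l by simp
    also have "\<dots> = X $$ (i, j)"
    proof (cases "0 < Z $$ (l, j)")
      case True
      thus ?thesis
        using col_cong[OF i j l(1)] positive_entry[OF i l(1)] \<sigma>_supp[OF l(1)] l
          ds_projection_eq_diag[OF proj l(1) j] ds_projection_eq_diag[OF proj j l(1)] ds_projection_sym[OF proj l(1) j] by simp
    next
      case False
      hence "\<not> 0 < X $$ (i, j)" using same_row[OF i l(1) j] \<sigma>_supp[OF l(1)] l by auto
      thus ?thesis using False nn[OF i j] ds_projection_nonneg[OF proj l(1) j] by simp
    qed
    finally show "(Q * Z) $$ (i, j) = X $$ (i, j)" .
  qed (use carrier_matD[OF Xc] carrier_matD[OF Qc] carrier_matD[OF Zc] in simp_all)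
  have "Z = X * transpose_mat X" by (simp add: Z_def normal)
  also have "\<dots> = Q * (Z * Z) * transpose_mat Q"
    unfolding QZ[symmetric] by (simp add: transpose_mult[of _ n n _ n] Zt assoc)
  finally have "Z = Q * Z * transpose_mat Q" by (simp only: ZZ)
  from arg_cong[OF this, of "\<lambda>M. M * Q"] have "Z * Q = Q * Z * (transpose_mat Q * Q)"
    by (simp add: assoc)
  hence "Z * Q = X"
    by (simp add: permutation_matrix_mult_transpose[OF Q] QZ right_mult_one_mat[OF Xc])
  with Q QZ that show thesis by blast
qed

lemma ds_projection_decoupled:
  assumes Z: "doubly_stochastic_projection n Z" and a: "a < n" and b: "b < n"
    and ne: "support_class n Z a \<noteq> support_class n Z b"
  shows "Z $$ (a, b) = 0"
  using support_class_cong[OF Z a b] ds_projection_nonneg[OF Z a b] ne by fastforce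

text \<open>
  Commuting with \<open>Z\<close> gives \<open>Z (\<pi> b, \<pi> b) = Z (b, b)\<close> for the underlying permutation \<open>\<pi>\<close>, and a diagonal
  entry is the reciprocal of the class size.
\<close>

lemma commuting_permutation_preserves_class_size:
  assumes Z: "doubly_stochastic_projection n Z" and P: "permutation_matrix n P"
    and comm: "P * Z = Z * P" and a: "a < n" and b: "b < n" and ne: "P $$ (a, b) \<noteq> 0"
  shows "card (support_class n Z a) = card (support_class n Z b)"
proof -
  from P obtain \<pi> where \<pi>: "\<pi> permutes {..<n}"
    and P_eq: "P = mat n n (\<lambda>(i, j). if i = \<pi> j then 1 else 0)" by (rule permutation_matrixE)
  have Pc: "P \<in> carrier_mat n n" by (simp add: P_eq)
  have Zc: "Z \<in> carrier_mat n n" by (rule ds_projection_carrier[OF Z])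
  have a_eq: "a = \<pi> b" using ne a b by (auto simp: P_eq split: if_splits)
  have "Z $$ (a, a) = (\<Sum>k<n. if k = a then Z $$ (a, k) else 0)" using a by simp
  also have "\<dots> = (Z * P) $$ (a, b)"
    unfolding mult_entry[OF Zc Pc a b] using b
    by (intro sum.cong) (auto simp: P_eq a_eq)
  also have "\<dots> = (P * Z) $$ (a, b)" by (simp only: comm)
  also have "\<dots> = (\<Sum>k<n. if k = b then Z $$ (k, b) else 0)"
    unfolding mult_entry[OF Pc Zc a b] using a permutes_inj[OF \<pi>]
    by (intro sum.cong) (auto simp: P_eq a_eq inj_eq)
  also have "\<dots> = Z $$ (b, b)" using b by simp
  finally have "1 / real (card (support_class n Z a)) = 1 / real (card (support_class n Z b))"
    using ds_projection_diag_eq_inverse_card[OF Z a] ds_projection_diag_eq_inverse_card[OF Z b] by simp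
  thus ?thesis by simp
qed

section \<open>Reordering a matrix along a list of indices\<close>

definition reindex :: "nat list \<Rightarrow> real mat \<Rightarrow> real mat" where
  "reindex l M = mat (length l) (length l) (\<lambda>(a, b). M $$ (l ! a, l ! b))"

text \<open>
  Entries are taken in both orders, so that the blocks on both sides of the diagonal vanish when the
  indices are listed with those of \<open>R\<close> before those of \<open>S\<close>.
\<close>

definition decoupled :: "real mat \<Rightarrow> nat set \<Rightarrow> nat set \<Rightarrow> bool" where
  "decoupled M R S \<longleftrightarrow> (\<forall>a\<in>R. \<forall>b\<in>S. M $$ (a, b) = 0 \<and> M $$ (b, a) = 0)"

lemma reindex_carrier [simp]: "reindex l M \<in> carrier_mat (length l) (length l)"
  by (simp add: reindex_def)

lemma reindex_dim [simp]:
  "dim_row (reindex l M) = length l" "dim_col (reindex l M) = length l"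
  by (simp_all add: reindex_def)

lemma reindex_append:
  assumes "decoupled M (set xs) (set ys)"
  shows "reindex (xs @ ys) M = four_block_mat
    (reindex xs M) (0\<^sub>m (length xs) (length ys)) (0\<^sub>m (length ys) (length xs)) (reindex ys M)"
  using assms
  by (intro eq_matI) (auto simp: reindex_def nth_append decoupled_def)

lemma reindex_concat:
  assumes "sorted_wrt (\<lambda>xs ys. decoupled M (set xs) (set ys)) xss"
  shows "reindex (concat xss) M = diag_block_mat (map (\<lambda>xs. reindex xs M) xss)"
  using assms
proof (induction xss)
  case Nil
  show ?case by (intro eq_matI) auto
next
  case (Cons xs xss)
  have "decoupled M (set xs) (set (concat xss))"
    using Cons.prems by (auto simp: decoupled_def)
  moreover have IH: "reindex (concat xss) M = diag_block_mat (map (\<lambda>xs. reindex xs M) xss)"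
    using Cons by simp
  ultimately show ?case
    by (simp add: reindex_append Let_def flip: IH)
qed

text \<open>
  In the sum defining an entry of \<open>M N\<close> with row index in \<open>l\<close>, only summation indices in \<open>l\<close>
  survive. A long product is thus reindexed by peeling off its factors from the left.
\<close>

lemma reindex_mult:
  assumes l: "distinct l" "set l \<subseteq> {..<n}"
    and M: "M \<in> carrier_mat n n" and N: "N \<in> carrier_mat n n"
    and dec: "decoupled M (set l) ({..<n} - set l)"
  shows "reindex l (M * N) = reindex l M * reindex l N"
proof (rule eq_matI)
  fix a b assume "a < dim_row (reindex l M * reindex l N)" "b < dim_col (reindex l M * reindex l N)"
  hence a: "a < length l" and b: "b < length l" by auto
  hence la: "l ! a < n" "l ! b < n" using l by (meson lessThan_iff nth_mem subsetD)+
  have "reindex l (M * N) $$ (a, b) = (\<Sum>c<n. M $$ (l ! a, c) * N $$ (c, l ! b))"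
    using a b mult_entry[OF M N la] by (simp add: reindex_def)
  also have "\<dots> = (\<Sum>c\<in>set l. M $$ (l ! a, c) * N $$ (c, l ! b))"
    using l a dec by (intro sum.mono_neutral_right) (auto simp: decoupled_def)
  also have "\<dots> = (\<Sum>k<length l. M $$ (l ! a, l ! k) * N $$ (l ! k, l ! b))"
    by (rule sum.reindex_bij_betw[OF bij_betw_nth, symmetric]) (use l in auto)
  also have "\<dots> = (reindex l M * reindex l N) $$ (a, b)"
    using a b mult_entry[of "reindex l M" "length l" "reindex l N" a b]
    by (simp add: reindex_def)
  finally show "reindex l (M * N) $$ (a, b) = (reindex l M * reindex l N) $$ (a, b)" .
qed auto

text \<open>
  Because \<open>P\<close> has no entries leaving the listed set, its permutation maps this set into itself and so
  induces a permutation of the positions in the list.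
\<close>

lemma reindex_permutation_matrix:
  assumes l: "distinct l" "set l \<subseteq> {..<n}" and P: "permutation_matrix n P"
    and dec: "decoupled P (set l) ({..<n} - set l)"
  shows "permutation_matrix (length l) (reindex l P)"
proof -
  from P obtain \<pi> where \<pi>: "\<pi> permutes {..<n}"
    and P_eq: "P = mat n n (\<lambda>(i, j). if i = \<pi> j then 1 else 0)" by (rule permutation_matrixE)
  have l_less: "l ! b < n" if "b < length l" for b
    using l that by (meson lessThan_iff nth_mem subsetD)
  have "\<exists>c<length l. l ! c = \<pi> (l ! b)" if b: "b < length l" for b
  proof -
    have "P $$ (\<pi> (l ! b), l ! b) = 1" "\<pi> (l ! b) < n"
      using l_less[OF b] permutes_in_image[OF \<pi>, of "l ! b"] by (auto simp: P_eq)
    hence "\<pi> (l ! b) \<in> set l"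
      using dec nth_mem[OF b] unfolding decoupled_def by (metis DiffI lessThan_iff zero_neq_one)
    thus ?thesis by (auto simp: in_set_conv_nth)
  qed
  then obtain \<rho>' where \<rho>': "\<And>b. b < length l \<Longrightarrow> \<rho>' b < length l \<and> l ! \<rho>' b = \<pi> (l ! b)"
    by metis
  define \<rho> where "\<rho> b = (if b < length l then \<rho>' b else b)" for b
  have "\<rho> permutes {..<length l}"
  proof (rule inj_imp_permutes)
    show "inj_on \<rho> {..<length l}"
    proof (rule inj_onI)
      fix a b assume "a \<in> {..<length l}" "b \<in> {..<length l}" "\<rho> a = \<rho> b"
      hence "a < length l" "b < length l" "\<pi> (l ! a) = \<pi> (l ! b)"
        using \<rho>'[of a] \<rho>'[of b] by (auto simp: \<rho>_def)
      thus "a = b" using permutes_inj[OF \<pi>] l by (auto simp: inj_eq nth_eq_iff_index_eq)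
    qed
  qed (use \<rho>' in \<open>auto simp: \<rho>_def\<close>)
  moreover have "reindex l P = mat (length l) (length l) (\<lambda>(i, j). if i = \<rho> j then 1 else 0)"
  proof (rule eq_matI)
    fix a b
    assume "a < dim_row (mat (length l) (length l) (\<lambda>(i, j). if i = \<rho> j then 1 else (0 :: real)))"
      "b < dim_col (mat (length l) (length l) (\<lambda>(i, j). if i = \<rho> j then 1 else (0 :: real)))"
    hence a: "a < length l" and b: "b < length l" by auto
    have "l ! a = \<pi> (l ! b) \<longleftrightarrow> a = \<rho>' b"
      using \<rho>'[OF b] a l by (metis nth_eq_iff_index_eq)
    thus "reindex l P $$ (a, b) = mat (length l) (length l) (\<lambda>(i, j). if i = \<rho> j then 1 else 0) $$ (a, b)"
      using a b l_less by (simp add: reindex_def P_eq \<rho>_def)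
  qed auto
  ultimately show ?thesis unfolding permutation_matrix_def by blast
qed

definition list_permutation_matrix :: "nat list \<Rightarrow> real mat" where
  "list_permutation_matrix l = mat (length l) (length l) (\<lambda>(i, j). if i = l ! j then 1 else 0)"

lemma list_permutation_matrix:
  assumes l: "distinct l" "set l = {..<n}"
  shows "permutation_matrix n (list_permutation_matrix l)"
proof -
  have len: "length l = n" using distinct_card[OF l(1)] l(2) by simp
  define \<pi> where "\<pi> j = (if j < n then l ! j else j)" for j
  have "\<pi> permutes {..<n}"
  proof (rule inj_imp_permutes)
    show "inj_on \<pi> {..<n}"
      using l len by (auto simp: inj_on_def \<pi>_def nth_eq_iff_index_eq)
    show "\<pi> j \<in> {..<n}" if "j \<in> {..<n}" for j
      using that l len nth_mem[of j l] by (auto simp: \<pi>_def)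
  qed (auto simp: \<pi>_def)
  moreover have "list_permutation_matrix l = mat n n (\<lambda>(i, j). if i = \<pi> j then 1 else 0)"
    unfolding list_permutation_matrix_def len by (intro eq_matI) (auto simp: \<pi>_def)
  ultimately show ?thesis unfolding permutation_matrix_def by blast
qed

lemma conjugate_list_permutation_matrix:
  assumes l: "distinct l" "set l = {..<n}" and M: "M \<in> carrier_mat n n"
  defines "T \<equiv> list_permutation_matrix l"
  shows "transpose_mat T * M * T = reindex l M"
proof -
  have len: "length l = n" using distinct_card[OF l(1)] l(2) by simp
  have T: "T \<in> carrier_mat n n" by (simp add: T_def list_permutation_matrix_def len)
  have Tt: "transpose_mat T \<in> carrier_mat n n" using T by simp
  have TM: "transpose_mat T * M \<in> carrier_mat n n" using Tt M by (rule mult_carrier_mat)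
  have l_less: "l ! a < n" if "a < n" for a using l len that nth_mem[of a l] by auto
  show ?thesis
  proof (rule eq_matI)
    fix a b assume "a < dim_row (reindex l M)" "b < dim_col (reindex l M)"
    hence a: "a < n" and b: "b < n" by (auto simp: len)
    have row: "(transpose_mat T * M) $$ (a, k) = M $$ (l ! a, k)" if k: "k < n" for k
    proof -
      have "(transpose_mat T * M) $$ (a, k) = (\<Sum>i<n. transpose_mat T $$ (a, i) * M $$ (i, k))"
        by (rule mult_entry[OF Tt M a k])
      also have "\<dots> = (\<Sum>i<n. if i = l ! a then M $$ (i, k) else 0)"
        using a T by (intro sum.cong) (auto simp: T_def list_permutation_matrix_def len)
      also have "\<dots> = M $$ (l ! a, k)" using l_less[OF a] by simp
      finally show ?thesis .
    qed
    have "(transpose_mat T * M * T) $$ (a, b) = (\<Sum>k<n. (transpose_mat T * M) $$ (a, k) * T $$ (k, b))"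
      by (rule mult_entry[OF TM T a b])
    also have "\<dots> = (\<Sum>k<n. if k = l ! b then M $$ (l ! a, k) else 0)"
      using b row
      by (intro sum.cong) (auto simp: T_def list_permutation_matrix_def len simp del: index_mult_mat(1))
    also have "\<dots> = reindex l M $$ (a, b)"
      using l_less[OF b] a b by (simp add: reindex_def len)
    finally show "(transpose_mat T * M * T) $$ (a, b) = reindex l M $$ (a, b)" .
  qed (use T len in auto)
qed

section \<open>Listing the indices by class size\<close>

lemma list_partition:
  assumes "finite F" and "\<And>C. C \<in> F \<Longrightarrow> finite C" and "disjoint F"
  shows "\<exists>xss. distinct (concat xss) \<and> set ` set xss = F \<and>
    sorted_wrt (\<lambda>xs ys. set xs \<inter> set ys = {}) xss \<and> (\<forall>xs\<in>set xss. distinct xs)"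
  using assms
proof (induction F rule: finite_induct)
  case empty
  show ?case by (intro exI[of _ "[]"]) auto
next
  case (insert C F)
  then obtain xss where xss: "distinct (concat xss)" "set ` set xss = F"
    "sorted_wrt (\<lambda>xs ys. set xs \<inter> set ys = {}) xss" "\<forall>xs\<in>set xss. distinct xs"
    by (auto simp: pairwise_insert)
  obtain xs where xs: "set xs = C" "distinct xs"
    using finite_distinct_list[of C] insert.prems by auto
  have dis: "C \<inter> set ys = {}" if "ys \<in> set xss" for ys
  proof -
    have "set ys \<in> F" using that xss(2) by auto
    thus ?thesis using insert.hyps insert.prems(2) by (auto simp: pairwise_def disjnt_def)
  qed
  show ?case
    by (rule exI[of _ "xs # xss"]) (use xs xss dis in auto)
qed

lemma distinct_concat_if_sorted_wrt_disjoint: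
  assumes "sorted_wrt (\<lambda>xs ys. set xs \<inter> set ys = {}) xss" and "\<forall>xs\<in>set xss. distinct xs"
  shows "distinct (concat xss)"
  using assms by (induction xss) auto

text \<open>
  The order of the indices behind the matrix \<open>T\<close> of the procedure: \<open>xss i\<close> lists the classes of size
  \<open>k i\<close>, each class being given as a list of its elements.
\<close>

lemma ds_projection_layout:
  assumes Z: "doubly_stochastic_projection n Z"
  obtains k :: "nat \<Rightarrow> nat" and m :: nat and xss :: "nat \<Rightarrow> nat list list" where
    "inj_on k {..<m}"
    and "\<And>i. i < m \<Longrightarrow> set (concat (xss i)) = {j. j < n \<and> card (support_class n Z j) = k i}"
    and "\<And>i. i < m \<Longrightarrow> set (concat (xss i)) \<noteq> {}"
    and "(\<Union>i<m. set (concat (xss i))) = {..<n}"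
    and "\<And>i. i < m \<Longrightarrow> distinct (concat (xss i))"
    and "\<And>i. i < m \<Longrightarrow> sorted_wrt (\<lambda>xs ys. decoupled Z (set xs) (set ys)) (xss i)"
    and "\<And>i xs. i < m \<Longrightarrow> xs \<in> set (xss i) \<Longrightarrow> distinct xs"
    and "\<And>i xs. i < m \<Longrightarrow> xs \<in> set (xss i) \<Longrightarrow> \<exists>j<n. set xs = support_class n Z j"
proof -
  let ?c = "support_class n Z"
  define ks where "ks = sorted_list_of_set ((\<lambda>j. card (?c j)) ` {..<n})"
  define S where "S i = {j. j < n \<and> card (?c j) = ks ! i}" for i
  have ks: "set ks = (\<lambda>j. card (?c j)) ` {..<n}" "distinct ks" by (simp_all add: ks_def)
  have "\<exists>xss. distinct (concat xss) \<and> set ` set xss = ?c ` S i \<and>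
    sorted_wrt (\<lambda>xs ys. set xs \<inter> set ys = {}) xss \<and> (\<forall>xs\<in>set xss. distinct xs)" for i
  proof (rule list_partition)
    show "disjoint (?c ` S i)"
      using support_class_disjoint[OF Z] by (auto simp: pairwise_def disjnt_def S_def)
  qed (auto simp: S_def finite_support_class[OF Z])
  then obtain xss where dist: "\<And>i. distinct (concat (xss i))"
    and classes: "\<And>i. set ` set (xss i) = ?c ` S i"
    and sorted: "\<And>i. sorted_wrt (\<lambda>xs ys. set xs \<inter> set ys = {}) (xss i)"
    and dist': "\<And>i xs. xs \<in> set (xss i) \<Longrightarrow> distinct xs"
    by metis
  have union: "set (concat (xss i)) = S i" for i
  proof -
    have "set (concat (xss i)) = \<Union> (?c ` S i)" unfolding classes[symmetric] by auto
    also have "\<dots> = S i"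
    proof (intro equalityI subsetI)
      fix x assume "x \<in> \<Union> (?c ` S i)"
      then obtain j where j: "j \<in> S i" "x < n" "0 < Z $$ (x, j)"
        by (auto simp: support_class_def)
      with support_class_cong[OF Z, of x j] show "x \<in> S i" by (auto simp: S_def)
    next
      fix x assume "x \<in> S i"
      thus "x \<in> \<Union> (?c ` S i)" using support_class_self[OF Z, of x] by (auto simp: S_def)
    qed
    finally show ?thesis .
  qed
  show thesis
  proof (rule that[of "(!) ks" "length ks" xss])
    show "inj_on ((!) ks) {..<length ks}"
      using ks(2) by (auto simp: inj_on_def nth_eq_iff_index_eq)
    show "set (concat (xss i)) = {j. j < n \<and> card (?c j) = ks ! i}" for i
      unfolding union S_def ..
    show "set (concat (xss i)) \<noteq> {}" if "i < length ks" for i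
      unfolding union S_def using nth_mem[OF that] ks(1) by auto
    show "(\<Union>i<length ks. set (concat (xss i))) = {..<n}"
    proof (intro equalityI subsetI)
      fix j assume j: "j \<in> {..<n}"
      hence "card (?c j) \<in> set ks" by (simp add: ks(1))
      then obtain i where "i < length ks" "ks ! i = card (?c j)" by (auto simp: in_set_conv_nth)
      hence "i < length ks" "j \<in> S i" using j by (simp_all add: S_def)
      thus "j \<in> (\<Union>i<length ks. set (concat (xss i)))" unfolding union by blast
    qed (unfold union, auto simp: S_def)
    show "distinct (concat (xss i))" for i by (rule dist)
    show "distinct xs" if "xs \<in> set (xss i)" for i xs using that by (rule dist')
    show cls: "\<exists>j<n. set xs = ?c j" if "xs \<in> set (xss i)" for i xs
    proof -
      have "set xs \<in> ?c ` S i" unfolding classes[symmetric] using that by (rule imageI)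
      thus ?thesis by (auto simp: S_def)
    qed
    show "sorted_wrt (\<lambda>xs ys. decoupled Z (set xs) (set ys)) (xss i)" for i
    proof (rule sorted_wrt_mono_rel[OF _ sorted])
      fix xs ys assume xs: "xs \<in> set (xss i)" and ys: "ys \<in> set (xss i)"
        and disj: "set xs \<inter> set ys = {}"
      obtain j l where jl: "j < n" "set xs = ?c j" "l < n" "set ys = ?c l"
        using cls[OF xs] cls[OF ys] by auto
      have "Z $$ (a, b) = 0 \<and> Z $$ (b, a) = 0" if ab: "a \<in> set xs" "b \<in> set ys" for a b
      proof -
        have a: "a < n" "?c a = ?c j"
          using ab jl support_class_cong[OF Z, of a j] by (auto simp: support_class_def)
        have b: "b < n" "?c b = ?c l"
          using ab jl support_class_cong[OF Z, of b l] by (auto simp: support_class_def)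
        have "?c a \<noteq> ?c b" using disj ab jl a b by auto
        thus ?thesis using ds_projection_decoupled[OF Z] a(1) b(1) by metis
      qed
      thus "decoupled Z (set xs) (set ys)" by (simp add: decoupled_def)
    qed
  qed
qed

text \<open>
  The remaining lemmas of this section concern lists \<open>l i\<close> of the level sets of a function \<open>c\<close> (below: the class
  size). A matrix whose nonzero entries only link indices of the same level becomes block diagonal.
\<close>

lemma level_lists_disjoint:
  fixes l :: "nat \<Rightarrow> nat list" and k c :: "nat \<Rightarrow> nat"
  assumes levels: "\<And>i. i < m \<Longrightarrow> set (l i) = {j. j < n \<and> c j = k i}"
    and inj: "inj_on k {..<m}" and "i < j" "j < m"
  shows "set (l i) \<inter> set (l j) = {}"
proof -
  have ne: "k i \<noteq> k j" using inj_onD[OF inj, of i j] assms(3,4) by auto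
  have "k i = k j" if "x \<in> set (l i)" "x \<in> set (l j)" for x
    using that levels[of i] levels[of j] assms(3,4) by simp
  with ne show ?thesis by blast
qed

lemma distinct_concat_levels:
  fixes l :: "nat \<Rightarrow> nat list" and k c :: "nat \<Rightarrow> nat"
  assumes levels: "\<And>i. i < m \<Longrightarrow> set (l i) = {j. j < n \<and> c j = k i}"
    and inj: "inj_on k {..<m}" and dist: "\<And>i. i < m \<Longrightarrow> distinct (l i)"
  shows "distinct (concat (map l [0..<m]))"
proof (rule distinct_concat_if_sorted_wrt_disjoint)
  show "sorted_wrt (\<lambda>xs ys. set xs \<inter> set ys = {}) (map l [0..<m])"
    unfolding sorted_wrt_map sorted_wrt_iff_nth_less
    by (simp add: level_lists_disjoint[of m l n c k, OF levels inj])
qed (use dist in auto)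

lemma level_decoupled:
  assumes sizes: "\<And>a b. a < n \<Longrightarrow> b < n \<Longrightarrow> M $$ (a, b) \<noteq> 0 \<Longrightarrow> c a = c b"
    and R: "R = {j. j < n \<and> c j = (v :: nat)}" and S: "S \<subseteq> {..<n}" "R \<inter> S = {}"
  shows "decoupled M R S"
  unfolding decoupled_def
proof (intro ballI)
  fix a b assume a: "a \<in> R" and b: "b \<in> S"
  have "a < n" "c a = v" using a unfolding R by simp_all
  moreover have "b < n" using b S(1) by blast
  moreover have "b \<notin> R" using b S(2) by blast
  hence "c b \<noteq> v" using \<open>b < n\<close> unfolding R by simp
  ultimately show "M $$ (a, b) = 0 \<and> M $$ (b, a) = 0" using sizes[of a b] sizes[of b a] by metis
qed

lemma reindex_concat_levels:
  fixes l :: "nat \<Rightarrow> nat list" and k c :: "nat \<Rightarrow> nat"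
  assumes levels: "\<And>i. i < m \<Longrightarrow> set (l i) = {j. j < n \<and> c j = k i}"
    and inj: "inj_on k {..<m}"
    and sizes: "\<And>a b. a < n \<Longrightarrow> b < n \<Longrightarrow> M $$ (a, b) \<noteq> 0 \<Longrightarrow> c a = c b"
  shows "reindex (concat (map l [0..<m])) M = block_diag m (\<lambda>i. reindex (l i) M)"
proof -
  have "decoupled M (set (l i)) (set (l j))" if "i < j" "j < m" for i j
  proof (rule level_decoupled[OF sizes levels])
    show "set (l j) \<subseteq> {..<n}" unfolding levels[OF that(2)] by auto
    show "set (l i) \<inter> set (l j) = {}" by (rule level_lists_disjoint[OF levels inj that])
  qed (use that in auto)
  hence "sorted_wrt (\<lambda>xs ys. decoupled M (set xs) (set ys)) (map l [0..<m])"
    by (simp add: sorted_wrt_map sorted_wrt_iff_nth_less)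
  thus ?thesis unfolding block_diag_def by (simp add: reindex_concat comp_def)
qed

section \<open>Products of block diagonal matrices\<close>

definition block_sizes :: "nat \<Rightarrow> (nat \<Rightarrow> nat) \<Rightarrow> (nat \<Rightarrow> real mat) \<Rightarrow> bool" where
  "block_sizes m d M \<longleftrightarrow> (\<forall>i<m. M i \<in> carrier_mat (d i) (d i))"

lemma block_sizes_mult:
  "block_sizes m d M \<Longrightarrow> block_sizes m d N \<Longrightarrow> block_sizes m d (\<lambda>i. M i * N i)"
  unfolding block_sizes_def by (meson mult_carrier_mat)

lemma block_diag_carrier:
  assumes "block_sizes m d M"
  shows "block_diag m M \<in> carrier_mat (\<Sum>i<m. d i) (\<Sum>i<m. d i)"
proof -
  have "map dim_row (map M [0..<m]) = map d [0..<m]" "map dim_col (map M [0..<m]) = map d [0..<m]"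
    using assms by (auto simp: block_sizes_def)
  thus ?thesis
    unfolding block_diag_def
    by (intro carrier_matI)
      (simp_all only: dim_diag_block_mat interv_sum_list_conv_sum_set_nat set_upt atLeast0LessThan)
qed

lemma block_diag_Suc:
  assumes "block_sizes (Suc m) d M"
  shows "block_diag (Suc m) M = four_block_mat (block_diag m M)
    (0\<^sub>m (\<Sum>i<m. d i) (d m)) (0\<^sub>m (d m) (\<Sum>i<m. d i)) (M m)"
proof -
  have "block_diag m M \<in> carrier_mat (\<Sum>i<m. d i) (\<Sum>i<m. d i)"
    by (rule block_diag_carrier) (use assms in \<open>auto simp: block_sizes_def\<close>)
  moreover have "M m \<in> carrier_mat (d m) (d m)" using assms by (simp add: block_sizes_def)
  ultimately show ?thesis
    by (auto simp: block_diag_def diag_block_mat_last Let_def)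
qed

lemma block_diag_mult:
  assumes "block_sizes m d M" and "block_sizes m d N"
  shows "block_diag m M * block_diag m N = block_diag m (\<lambda>i. M i * N i)"
  using assms
proof (induction m)
  case 0
  show ?case by (simp add: block_diag_def)
next
  case (Suc m)
  let ?s = "\<Sum>i<m. d i"
  have sizes: "block_sizes m d M" "block_sizes m d N"
    using Suc.prems by (auto simp: block_sizes_def)
  have M: "block_diag m M \<in> carrier_mat ?s ?s" "M m \<in> carrier_mat (d m) (d m)"
    using Suc.prems(1) block_diag_carrier[OF sizes(1)] by (auto simp: block_sizes_def)
  have N: "block_diag m N \<in> carrier_mat ?s ?s" "N m \<in> carrier_mat (d m) (d m)"
    using Suc.prems(2) block_diag_carrier[OF sizes(2)] by (auto simp: block_sizes_def)
  have IH: "block_diag m M * block_diag m N = block_diag m (\<lambda>i. M i * N i)"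
    using sizes by (rule Suc.IH)
  have M_Suc: "block_diag (Suc m) M
      = four_block_mat (block_diag m M) (0\<^sub>m ?s (d m)) (0\<^sub>m (d m) ?s) (M m)"
    by (rule block_diag_Suc[OF Suc.prems(1)])
  have N_Suc: "block_diag (Suc m) N
      = four_block_mat (block_diag m N) (0\<^sub>m ?s (d m)) (0\<^sub>m (d m) ?s) (N m)"
    by (rule block_diag_Suc[OF Suc.prems(2)])
  have "block_diag (Suc m) M * block_diag (Suc m) N
    = four_block_mat (block_diag m M * block_diag m N) (0\<^sub>m ?s (d m)) (0\<^sub>m (d m) ?s) (M m * N m)"
    unfolding M_Suc N_Suc
      mult_four_block_mat[OF M(1) zero_carrier_mat zero_carrier_mat M(2)
          N(1) zero_carrier_mat zero_carrier_mat N(2)]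
    using M N mult_carrier_mat[OF M(1) N(1)] mult_carrier_mat[OF M(2) N(2)] by simp
  also have "\<dots> = block_diag (Suc m) (\<lambda>i. M i * N i)"
    unfolding IH by (rule block_diag_Suc[OF block_sizes_mult[OF Suc.prems], symmetric])
  finally show ?case .
qed

lemma block_diag_cong: "(\<And>i. i < m \<Longrightarrow> M i = N i) \<Longrightarrow> block_diag m M = block_diag m N"
  unfolding block_diag_def by (metis atLeastLessThan_iff map_cong set_upt)

text \<open>
  The columns of \<open>Z\<close> lie in its range.
\<close>

lemma mult_eq_if_eq_on_range:
  fixes M N Z :: "real mat"
  assumes M: "M \<in> carrier_mat n n" and N: "N \<in> carrier_mat n n" and Z: "Z \<in> carrier_mat n n"
    and eq: "\<forall>v\<in>mat_range Z. M *\<^sub>v v = N *\<^sub>v v"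
  shows "M * Z = N * Z"
proof (rule eq_matI)
  have col: "col (M * Z) j = col (N * Z) j" if j: "j < n" for j
  proof -
    have "Z *\<^sub>v unit_vec n j \<in> mat_range Z" using Z by (auto simp: mat_range_def)
    with eq have "M *\<^sub>v (Z *\<^sub>v unit_vec n j) = N *\<^sub>v (Z *\<^sub>v unit_vec n j)" by blast
    moreover have "Z *\<^sub>v unit_vec n j = col Z j"
      using Z j by (intro eq_vecI) auto
    ultimately show ?thesis
      using j Z by (simp add: col_mult2[OF M Z j] col_mult2[OF N Z j])
  qed
  fix i j assume ij: "i < dim_row (N * Z)" "j < dim_col (N * Z)"
  thus "(M * Z) $$ (i, j) = (N * Z) $$ (i, j)"
    using arg_cong[OF col[of j], of "\<lambda>v. v $ i"] M N Z by simp
qed (use M N in auto)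

lemma eq_on_range_if_mult_eq:
  fixes M N Z :: "real mat"
  assumes M: "M \<in> carrier_mat n n" and N: "N \<in> carrier_mat n n" and Z: "Z \<in> carrier_mat n n"
    and eq: "M * Z = N * Z" and v: "v \<in> mat_range Z"
  shows "M *\<^sub>v v = N *\<^sub>v v"
proof -
  obtain w where w: "w \<in> carrier_vec n" "v = Z *\<^sub>v w" using v Z by (auto simp: mat_range_def)
  have "M *\<^sub>v v = (M * Z) *\<^sub>v w"
    unfolding w(2) by (rule assoc_mult_mat_vec[OF M Z w(1), symmetric])
  also have "\<dots> = N *\<^sub>v v"
    unfolding w(2) eq by (rule assoc_mult_mat_vec[OF N Z w(1)])
  finally show ?thesis .
qed

section \<open>From the procedure to the equation\<close>

lemma uniform_blocks_carrier:
  "k dvd d \<Longrightarrow> diag_block_mat (replicate (d div k) (uniform_mat k)) \<in> carrier_mat d d"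
  by (intro carrier_matI) (simp_all add: dim_diag_block_mat uniform_mat_def sum_list_replicate)

text \<open>
  Conjugation by \<open>T\<close> is multiplicative, so the blockwise identities carry over to
  \<open>A\<close>, \<open>Z\<close> and \<open>Q = T diag(Q') T\<^sup>-\<^sup>1\<close>, and the rest happens with \<open>n \<times> n\<close> matrices. For the kernels, \<open>X = QZ\<close>
  and \<open>Z = RX\<close>, where \<open>R\<close> has the transposed blocks of \<open>Q\<close>.
\<close>

lemma obtained_by_procedure_sound:
  assumes Ac: "A \<in> carrier_mat n n" and obt: "obtained_by_procedure n A W X"
  shows "A * X * A = X * A * X" and "mat_kernel X = W"
proof -
  from obt obtain Z T T' m d k Z' A' Q' X' where
    Zp: "orthogonal_projector n Z" and ker: "mat_kernel Z = W" and "doubly_stochastic n Z" and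
    T: "permutation_matrix n T" and T'c: "T' \<in> carrier_mat n n" and
    inv: "inverts_mat T T'" "inverts_mat T' T" and "inj_on k {..<m}" and
    blocks': "\<forall>i<m. 0 < k i \<and> 0 < d i \<and> k i dvd d i \<and>
               Z' i = diag_block_mat (replicate (d i div k i) (uniform_mat (k i)))" and
    Z_block: "T' * Z * T = block_diag m Z'" and
    A_block: "T' * A * T = block_diag m A'" and
    A'_props: "\<forall>i<m. permutation_matrix (d i) (A' i) \<and> A' i * Z' i = Z' i * A' i" and
    Q'_props: "\<forall>i<m. permutation_matrix (d i) (Q' i) \<and> Q' i * Z' i = Z' i * Q' i \<and>
               (\<forall>v\<in>mat_range (Z' i).
                  (A' i * Q' i * A' i) *\<^sub>v v = (Q' i * A' i * Q' i) *\<^sub>v v)" and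
    X'_eq: "\<forall>i<m. X' i = Z' i * Q' i" and
    X: "X = T * block_diag m X' * T'"
    unfolding obtained_by_procedure_def by (elim exE conjE) (rule that; assumption)
  note blocks = blocks'[rule_format] and A' = A'_props[rule_format]
    and Q' = Q'_props[rule_format] and X' = X'_eq[rule_format]
  note assoc = assoc_mult_mat[of _ n n _ n _ n] mult_carrier_mat[of _ n n _ n]
  have Zc[simp]: "Z \<in> carrier_mat n n" and ZZ: "Z * Z = Z"
    using Zp by (auto simp: orthogonal_projector_def)
  have Tc[simp]: "T \<in> carrier_mat n n" using T by (rule permutation_matrix_carrier)
  note T'c[simp] Ac[simp]
  have TT': "T * T' = 1\<^sub>m n" and T'T: "T' * T = 1\<^sub>m n"
    using inv Tc T'c by (auto simp: inverts_mat_def)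
  have cancel: "T' * (T * M) = M" "T * (T' * M) = M" if "M \<in> carrier_mat n n" for M
    using that by (simp_all add: assoc_mult_mat[of _ n n _ n _ n, symmetric] TT' T'T)

  have A's: "block_sizes m d A'" and Q's: "block_sizes m d Q'"
    using A' Q' by (auto simp: block_sizes_def intro: permutation_matrix_carrier)
  have Z's: "block_sizes m d Z'"
    using blocks uniform_blocks_carrier unfolding block_sizes_def by metis
  have X's: "block_sizes m d X'"
    using block_sizes_mult[OF Z's Q's] X' by (simp add: block_sizes_def)
  have n: "(\<Sum>i<m. d i) = n"
    using arg_cong[OF Z_block, of dim_row] block_diag_carrier[OF Z's] carrier_matD[OF T'c] by auto
  have bc: "block_diag m M \<in> carrier_mat n n" if "block_sizes m d M" for M
    using block_diag_carrier[OF that] n by simp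
  note [simp] = bc[OF A's] bc[OF Q's] bc[OF Z's] bc[OF X's]
  have A_eq: "A = T * block_diag m A' * T'"
    unfolding A_block[symmetric] by (simp add: assoc cancel TT' T'T right_mult_one_mat[OF Ac])
  have Z_eq: "Z = T * block_diag m Z' * T'"
    unfolding Z_block[symmetric] by (simp add: assoc cancel TT' T'T right_mult_one_mat[OF Zc])

  have conj_mult: "T * M * T' * (T * N * T') = T * (M * N) * T'"
    if "M \<in> carrier_mat n n" "N \<in> carrier_mat n n" for M N
    using that by (simp add: assoc cancel)
  define Q where "Q = T * block_diag m Q' * T'"
  have Qc[simp]: "Q \<in> carrier_mat n n" by (simp add: Q_def assoc)
  have AZ: "A * Z = Z * A"
  proof -
    have "block_diag m A' * block_diag m Z' = block_diag m Z' * block_diag m A'"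
      unfolding block_diag_mult[OF A's Z's] block_diag_mult[OF Z's A's]
      by (rule block_diag_cong) (use A' in auto)
    thus ?thesis by (simp only: A_eq Z_eq conj_mult bc[OF A's] bc[OF Z's])
  qed
  have QZ: "Q * Z = Z * Q"
  proof -
    have "block_diag m Q' * block_diag m Z' = block_diag m Z' * block_diag m Q'"
      unfolding block_diag_mult[OF Q's Z's] block_diag_mult[OF Z's Q's]
      by (rule block_diag_cong) (use Q' in auto)
    thus ?thesis by (simp only: Q_def Z_eq conj_mult bc[OF Q's] bc[OF Z's])
  qed
  have X_eq: "X = Z * Q"
  proof -
    have "block_diag m X' = block_diag m Z' * block_diag m Q'"
      unfolding block_diag_mult[OF Z's Q's] by (rule block_diag_cong) (rule X')
    thus ?thesis by (simp only: X Q_def Z_eq conj_mult bc[OF Q's] bc[OF Z's])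
  qed
  have AQAZ: "A * Q * A * Z = Q * A * Q * Z"
  proof -
    note AQ = block_sizes_mult[OF A's Q's] and QA = block_sizes_mult[OF Q's A's]
    note AQA = block_sizes_mult[OF AQ A's] and QAQ = block_sizes_mult[OF QA Q's]
    have "block_diag m (\<lambda>i. A' i * Q' i * A' i * Z' i) = block_diag m (\<lambda>i. Q' i * A' i * Q' i * Z' i)"
    proof (rule block_diag_cong)
      fix i assume i: "i < m"
      show "A' i * Q' i * A' i * Z' i = Q' i * A' i * Q' i * Z' i"
        by (rule mult_eq_if_eq_on_range[of _ "d i"])
          (use AQA QAQ Z's Q' i in \<open>simp_all add: block_sizes_def\<close>)
    qed
    hence "block_diag m A' * block_diag m Q' * block_diag m A' * block_diag m Z'
        = block_diag m Q' * block_diag m A' * block_diag m Q' * block_diag m Z'"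
      unfolding block_diag_mult[OF A's Q's] block_diag_mult[OF Q's A's] block_diag_mult[OF AQ A's]
        block_diag_mult[OF QA Q's] block_diag_mult[OF AQA Z's] block_diag_mult[OF QAQ Z's] .
    thus ?thesis by (simp only: A_eq Q_def Z_eq conj_mult bc[OF Q's] bc[OF Z's] bc[OF A's] mult_carrier_mat[of _ n n _ n])
  qed

  \<comment> \<open>Move every \<open>Z\<close> to the right, exchange \<open>AQA\<close> for \<open>QAQ\<close>, then duplicate \<open>Z\<close> and distribute it.\<close>
  have "A * X * A = A * Q * (Z * A)" unfolding X_eq QZ[symmetric] by (simp add: assoc)
  also have "\<dots> = A * Q * A * Z" unfolding AZ[symmetric] by (simp add: assoc)
  also have "\<dots> = Q * A * Q * (Z * Z)" unfolding AQAZ ZZ ..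
  also have "\<dots> = Q * A * (Q * Z) * Z" by (simp add: assoc)
  also have "\<dots> = Q * A * (Z * Q) * Z" by (simp only: QZ)
  also have "\<dots> = Q * (A * Z) * (Q * Z)" by (simp add: assoc)
  also have "\<dots> = Q * (Z * A) * (Z * Q)" by (simp only: AZ QZ)
  also have "\<dots> = (Q * Z) * A * (Z * Q)" by (simp add: assoc)
  also have "\<dots> = X * A * X" by (simp only: X_eq QZ)
  finally show "A * X * A = X * A * X" .

  define R where "R = T * block_diag m (\<lambda>i. transpose_mat (Q' i)) * T'"
  have Q'ts: "block_sizes m d (\<lambda>i. transpose_mat (Q' i))"
    using Q's by (simp add: block_sizes_def)
  note [simp] = bc[OF Q'ts]
  have Rc: "R \<in> carrier_mat n n" by (simp add: R_def assoc)
  have "R * X = Z"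
  proof -
    have "block_diag m (\<lambda>i. transpose_mat (Q' i)) * block_diag m X' = block_diag m Z'"
      unfolding block_diag_mult[OF Q'ts X's]
    proof (rule block_diag_cong)
      fix i assume i: "i < m"
      have "transpose_mat (Q' i) * X' i = transpose_mat (Q' i) * (Q' i * Z' i)"
        using Q'[OF i] X'[OF i] by simp
      also have "\<dots> = transpose_mat (Q' i) * Q' i * Z' i"
        by (rule assoc_mult_mat[of _ "d i" "d i" _ "d i" _ "d i", symmetric])
          (use Q's Z's i in \<open>auto simp: block_sizes_def\<close>)
      also have "\<dots> = Z' i"
        using permutation_matrix_mult_transpose(2)[of "d i" "Q' i"] Q'[OF i] Z's i
          left_mult_one_mat[of "Z' i" "d i" "d i"]
        by (simp add: block_sizes_def)
      finally show "transpose_mat (Q' i) * X' i = Z' i" .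
    qed
    thus ?thesis by (simp only: X R_def Z_eq conj_mult bc[OF Q'ts] bc[OF X's])
  qed
  moreover have Xc: "X \<in> carrier_mat n n" by (simp add: X assoc)
  ultimately have "mat_kernel X \<subseteq> mat_kernel Z"
    using mat_kernel_mult_subset[OF Xc Rc] by simp
  moreover have "mat_kernel Z \<subseteq> mat_kernel X"
    using mat_kernel_mult_subset[OF Zc Qc] by (simp add: X_eq QZ)
  ultimately show "mat_kernel X = W" using ker by simp
qed

section \<open>From the equation to the procedure\<close>

text \<open>
  All data of the procedure are reindexed versions of \<open>A\<close>, \<open>Q\<close> and \<open>Z\<close>. Reindexing along one block is
  multiplicative on these matrices, since none of them links indices of different class sizes.
\<close>

lemma braid_obtained_by_procedure:
  assumes A: "permutation_matrix n A" and X: "doubly_stochastic n X"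
    and braid: "A * X * A = X * A * X"
  shows "obtained_by_procedure n A (mat_kernel X) X"
proof -
  have Ac[simp]: "A \<in> carrier_mat n n" using A by (rule permutation_matrix_carrier)
  have Xc[simp]: "X \<in> carrier_mat n n" using X by (rule doubly_stochastic_carrier)
  note assoc = assoc_mult_mat[of _ n n _ n _ n] mult_carrier_mat[of _ n n _ n]
  define Z where "Z = transpose_mat X * X"
  note partial_isometry = braid_normal_partial_isometry[OF A X braid, folded Z_def]
  have Zc[simp]: "Z \<in> carrier_mat n n" by (simp add: Z_def assoc)
  have "transpose_mat Z = Z" by (simp add: Z_def transpose_mult[of _ n n _ n])
  moreover have Z_ds: "doubly_stochastic n Z"
    unfolding Z_def using X by (intro doubly_stochastic_mult doubly_stochastic_transpose)
  ultimately have Z: "doubly_stochastic_projection n Z"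
    using partial_isometry(4) by (simp add: doubly_stochastic_projection_def orthogonal_projector_def)
  have ker: "mat_kernel Z = mat_kernel X"
    using mat_kernel_mult_subset[OF Zc Xc] mat_kernel_mult_subset[OF Xc, of "transpose_mat X" n]
    by (simp add: partial_isometry(2)) (simp add: Z_def)
  obtain Q where Q: "permutation_matrix n Q" and QZ: "Q * Z = X" and ZQ: "Z * Q = X"
    using normal_partial_isometry_permutation_times_projection[OF X]
      partial_isometry(1,2) unfolding Z_def by metis
  have Qc[simp]: "Q \<in> carrier_mat n n" using Q by (rule permutation_matrix_carrier)

  obtain k :: "nat \<Rightarrow> nat" and m :: nat and xss :: "nat \<Rightarrow> nat list list"
    where inj: "inj_on k {..<m}"
    and set_block: "\<And>i. i < m \<Longrightarrow> set (concat (xss i)) = {j. j < n \<and> card (support_class n Z j) = k i}"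
    and nonempty: "\<And>i. i < m \<Longrightarrow> set (concat (xss i)) \<noteq> {}"
    and cover: "(\<Union>i<m. set (concat (xss i))) = {..<n}"
    and dist: "\<And>i. i < m \<Longrightarrow> distinct (concat (xss i))"
    and dec_classes: "\<And>i. i < m \<Longrightarrow> sorted_wrt (\<lambda>xs ys. decoupled Z (set xs) (set ys)) (xss i)"
    and dist_class: "\<And>i xs. i < m \<Longrightarrow> xs \<in> set (xss i) \<Longrightarrow> distinct xs"
    and cls: "\<And>i xs. i < m \<Longrightarrow> xs \<in> set (xss i) \<Longrightarrow> \<exists>j<n. set xs = support_class n Z j"
    by (rule ds_projection_layout[OF Z]) (rule that; assumption)
  define l where "l i = concat (xss i)" for i
  define d where "d i = length (l i)" for i
  define L where "L = concat (map l [0..<m])"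
  have set_l: "set (l i) = {j. j < n \<and> card (support_class n Z j) = k i}" if "i < m" for i
    using set_block[OF that] by (simp add: l_def)
  have l: "distinct (l i)" "set (l i) \<subseteq> {..<n}" if "i < m" for i
    using dist[OF that] set_l[OF that] by (auto simp: l_def)
  have L: "distinct L" "set L = {..<n}"
  proof -
    show "distinct L" unfolding L_def by (rule distinct_concat_levels[OF set_l inj l(1)])
    show "set L = {..<n}" using cover by (simp add: L_def l_def atLeast0LessThan)
  qed
  have off_block: "decoupled M (set (l i)) ({..<n} - set (l i))"
    if sizes: "\<And>a b. a < n \<Longrightarrow> b < n \<Longrightarrow> M $$ (a, b) \<noteq> 0 \<Longrightarrow>
        card (support_class n Z a) = card (support_class n Z b)" and i: "i < m" for M i
    by (rule level_decoupled[OF sizes set_l[OF i]]) auto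
  have block: "reindex L M = block_diag m (\<lambda>i. reindex (l i) M)"
    if sizes: "\<And>a b. a < n \<Longrightarrow> b < n \<Longrightarrow> M $$ (a, b) \<noteq> 0 \<Longrightarrow>
        card (support_class n Z a) = card (support_class n Z b)" for M
    unfolding L_def by (rule reindex_concat_levels[OF set_l inj sizes])
  have sizes_Z: "card (support_class n Z a) = card (support_class n Z b)"
    if "a < n" "b < n" "Z $$ (a, b) \<noteq> 0" for a b
    using ds_projection_decoupled[OF Z] that by metis
  note sizes_A = commuting_permutation_preserves_class_size[OF Z A partial_isometry(5)]
  note sizes_Q = commuting_permutation_preserves_class_size[OF Z Q QZ[folded ZQ]]
  note off_A = off_block[OF sizes_A] and off_Q = off_block[OF sizes_Q]
    and off_Z = off_block[OF sizes_Z]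

  have Z_block: "0 < k i \<and> 0 < d i \<and> k i dvd d i \<and>
      reindex (l i) Z = diag_block_mat (replicate (d i div k i) (uniform_mat (k i)))"
    if i: "i < m" for i
  proof -
    obtain j where "j \<in> set (l i)" using nonempty[OF i] unfolding l_def by (metis ex_in_conv)
    hence "j < n" "card (support_class n Z j) = k i" using set_l[OF i] by auto
    hence k_pos: "0 < k i"
      using support_class_self[OF Z, of j] finite_support_class[OF Z, of j]
      by (metis card_gt_0_iff empty_iff)
    have len: "length xs = k i" and uni: "reindex xs Z = uniform_mat (k i)"
      if xs: "xs \<in> set (xss i)" for xs
    proof -
      obtain j where j: "j < n" "set xs = support_class n Z j" using cls[OF i xs] by blast
      have "j \<in> set (l i)" using support_class_self[OF Z j(1)] j(2) xs by (auto simp: l_def)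
      hence card: "card (support_class n Z j) = k i" using set_l[OF i] by auto
      show len: "length xs = k i" using distinct_card[OF dist_class[OF i xs]] j(2) card by simp
      have "Z $$ (a, b) = 1 / real (k i)" if a: "a \<in> set xs" and b: "b \<in> set xs" for a b
      proof -
        have an: "a < n" "0 < Z $$ (a, j)" and bn: "b < n" "0 < Z $$ (b, j)"
          using a b j by (auto simp: support_class_def)
        have "Z $$ (a, b) = Z $$ (j, b)" by (rule ds_projection_row_cong[OF Z an(1) j(1) bn(1) an(2)])
        also have "\<dots> = Z $$ (b, j)" by (rule ds_projection_sym[OF Z j(1) bn(1)])
        also have "\<dots> = Z $$ (j, j)" by (rule ds_projection_eq_diag[OF Z bn(1) j(1) bn(2)])
        finally show ?thesis using ds_projection_diag_eq_inverse_card[OF Z j(1)] card by simp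
      qed
      thus "reindex xs Z = uniform_mat (k i)"
        by (intro eq_matI) (auto simp: reindex_def uniform_mat_def len)
    qed
    have "map length (xss i) = replicate (length (xss i)) (k i)"
      using len by (intro nth_equalityI) auto
    hence d_eq: "d i = length (xss i) * k i"
      by (simp add: d_def l_def length_concat sum_list_replicate)
    have "0 < d i"
      using nonempty[OF i] unfolding d_def l_def length_greater_0_conv by (metis set_empty)
    moreover have "map (\<lambda>xs. reindex xs Z) (xss i) = replicate (length (xss i)) (uniform_mat (k i))"
      using uni by (intro nth_equalityI) auto
    hence "reindex (l i) Z = diag_block_mat (replicate (d i div k i) (uniform_mat (k i)))"
      unfolding l_def reindex_concat[OF dec_classes[OF i]] using k_pos by (simp add: d_eq)
    ultimately show ?thesis using k_pos by (simp add: d_eq)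
  qed

  have A_block: "permutation_matrix (d i) (reindex (l i) A) \<and>
      reindex (l i) A * reindex (l i) Z = reindex (l i) Z * reindex (l i) A" if i: "i < m" for i
    using reindex_permutation_matrix[OF l[OF i] A off_A[OF _ _ _ i]]
      reindex_mult[OF l[OF i] Ac Zc off_A[OF _ _ _ i]]
      reindex_mult[OF l[OF i] Zc Ac off_Z[OF _ _ _ i]]
    by (simp add: d_def partial_isometry(5))
  have Q_comm: "permutation_matrix (d i) (reindex (l i) Q) \<and>
      reindex (l i) Q * reindex (l i) Z = reindex (l i) Z * reindex (l i) Q" if i: "i < m" for i
    using reindex_permutation_matrix[OF l[OF i] Q off_Q[OF _ _ _ i]]
      reindex_mult[OF l[OF i] Qc Zc off_Q[OF _ _ _ i]]
      reindex_mult[OF l[OF i] Zc Qc off_Z[OF _ _ _ i]]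
    by (simp add: d_def QZ ZQ)
  have Q_braid: "(reindex (l i) A * reindex (l i) Q * reindex (l i) A) *\<^sub>v v
      = (reindex (l i) Q * reindex (l i) A * reindex (l i) Q) *\<^sub>v v"
    if i: "i < m" and v: "v \<in> mat_range (reindex (l i) Z)" for i v
  proof -
    let ?r = "reindex (l i)"
    note assoc_i = assoc_mult_mat[of _ "d i" "d i" _ "d i" _ "d i"]
      mult_carrier_mat[of _ "d i" "d i" _ "d i"]
    have c[simp]: "?r M \<in> carrier_mat (d i) (d i)" for M by (simp add: d_def)
    have mult_A: "?r (A * M) = ?r A * ?r M" if "M \<in> carrier_mat n n" for M
      by (rule reindex_mult[OF l[OF i] Ac that off_A[OF _ _ _ i]])
    have mult_Q: "?r (Q * M) = ?r Q * ?r M" if "M \<in> carrier_mat n n" for M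
      by (rule reindex_mult[OF l[OF i] Qc that off_Q[OF _ _ _ i]])
    \<comment> \<open>The equation reads \<open>AQAZ = AXA = XAX = QAQZ\<close>, once every \<open>Z\<close> is moved to the right.\<close>
    have "A * (Q * (A * Z)) = A * X * A"
      by (simp add: partial_isometry(5) assoc flip: QZ)
    also have "\<dots> = Q * Z * A * (Z * Q)" by (simp only: braid QZ ZQ)
    also have "\<dots> = Q * (Z * A) * (Z * Q)" by (simp add: assoc)
    also have "\<dots> = Q * A * (Z * Z) * Q" by (simp add: assoc flip: partial_isometry(5))
    also have "\<dots> = Q * A * (Z * Q)" by (simp add: partial_isometry(4) assoc)
    also have "\<dots> = Q * (A * (Q * Z))" by (simp add: QZ ZQ assoc)
    finally have "?r A * (?r Q * (?r A * ?r Z)) = ?r Q * (?r A * (?r Q * ?r Z))"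
      by (simp add: assoc flip: mult_A mult_Q)
    hence "?r A * ?r Q * ?r A * ?r Z = ?r Q * ?r A * ?r Q * ?r Z"
      by (simp add: assoc_i)
    thus ?thesis
      by (intro eq_on_range_if_mult_eq[OF _ _ _ _ v, of _ "d i"]) (simp_all add: assoc_i)
  qed

  have blocks_L: "reindex L A = block_diag m (\<lambda>i. reindex (l i) A)"
      "reindex L Q = block_diag m (\<lambda>i. reindex (l i) Q)"
      "reindex L Z = block_diag m (\<lambda>i. reindex (l i) Z)"
    by (rule block, erule (2) sizes_A sizes_Q sizes_Z)+
  define T where "T = list_permutation_matrix L"
  have T: "permutation_matrix n T" unfolding T_def by (rule list_permutation_matrix[OF L])
  have Tc[simp]: "T \<in> carrier_mat n n" using T by (rule permutation_matrix_carrier)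
  note TT = permutation_matrix_mult_transpose[OF T]
  note conjugate = conjugate_list_permutation_matrix[OF L, folded T_def]
  have X_block: "X = T * block_diag m (\<lambda>i. reindex (l i) Z * reindex (l i) Q) * transpose_mat T"
  proof -
    have "block_diag m (\<lambda>i. reindex (l i) Z * reindex (l i) Q) = reindex L Z * reindex L Q"
      unfolding blocks_L
      by (rule block_diag_mult[symmetric, where d = d]) (simp_all add: d_def block_sizes_def)
    also have "\<dots> = reindex L X"
      unfolding ZQ[symmetric]
      by (rule reindex_mult[symmetric, OF L(1) _ Zc Qc]) (simp_all add: L decoupled_def)
    also have "\<dots> = transpose_mat T * X * T" by (rule conjugate[symmetric]) simp
    finally have "T * block_diag m (\<lambda>i. reindex (l i) Z * reindex (l i) Q) * transpose_mat T
        = (T * transpose_mat T) * X * (T * transpose_mat T)" by (simp add: assoc)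
    thus ?thesis by (simp add: TT left_mult_one_mat[OF Xc] right_mult_one_mat[OF Xc])
  qed
  show ?thesis
    unfolding obtained_by_procedure_def
  proof (intro exI conjI)
    show "orthogonal_projector n Z" "doubly_stochastic n Z"
      using Z by (simp_all add: doubly_stochastic_projection_def)
    show "mat_kernel Z = mat_kernel X" by (rule ker)
    show "permutation_matrix n T" by (rule T)
    show "transpose_mat T \<in> carrier_mat n n" by simp
    show "inverts_mat T (transpose_mat T)" "inverts_mat (transpose_mat T) T"
      using TT carrier_matD[OF Tc] by (simp_all add: inverts_mat_def)
    show "inj_on k {..<m}" by (rule inj)
    show "\<forall>i<m. 0 < k i \<and> 0 < d i \<and> k i dvd d i \<and>
        reindex (l i) Z = diag_block_mat (replicate (d i div k i) (uniform_mat (k i)))"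
      using Z_block by blast
    show "transpose_mat T * Z * T = block_diag m (\<lambda>i. reindex (l i) Z)"
      using conjugate[OF Zc] blocks_L(3) by simp
    show "transpose_mat T * A * T = block_diag m (\<lambda>i. reindex (l i) A)"
      using conjugate[OF Ac] blocks_L(1) by simp
    show "\<forall>i<m. permutation_matrix (d i) (reindex (l i) A) \<and>
        reindex (l i) A * reindex (l i) Z = reindex (l i) Z * reindex (l i) A"
      using A_block by blast
    show "\<forall>i<m. permutation_matrix (d i) (reindex (l i) Q) \<and>
        reindex (l i) Q * reindex (l i) Z = reindex (l i) Z * reindex (l i) Q \<and>
        (\<forall>v\<in>mat_range (reindex (l i) Z).
          (reindex (l i) A * reindex (l i) Q * reindex (l i) A) *\<^sub>v v
          = (reindex (l i) Q * reindex (l i) A * reindex (l i) Q) *\<^sub>v v)"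
      using Q_comm Q_braid by blast
    show "\<forall>i<m. reindex (l i) Z * reindex (l i) Q = reindex (l i) Z * reindex (l i) Q" by simp
    show "X = T * block_diag m (\<lambda>i. reindex (l i) Z * reindex (l i) Q) * transpose_mat T"
      by (rule X_block)
  qed
qed

theorem theorem4p5:
  fixes n :: nat and A X :: "real mat"
  assumes "permutation_matrix n A"
    and "doubly_stochastic n X"
  shows "(A * X * A = X * A * X \<longleftrightarrow>
            (\<exists>W. invariant_subspace n A W \<and> obtained_by_procedure n A W X)) \<and>
         (\<forall>W. invariant_subspace n A W \<and> obtained_by_procedure n A W X \<longrightarrow> mat_kernel X = W)"
  using braid_invariant_subspace[OF assms] braid_obtained_by_procedure[OF assms]
    obtained_by_procedure_sound[OF permutation_matrix_carrier[OF assms(1)]]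
  by blast

end
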